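(* Let $U$ be the subalgebra of the $q$-shuffle algebra $(\mathbb V,\star)$ generated by $x$ and $y$. Let $\Omega$ be the set of elements $$\{W_{-i}\}_{i\in\mathbb N},\qquad \{\tilde G_{j+1}\}_{j\in\mathbb N},\qquad \{W_{k+1}\}_{k\in\mathbb N}.$$ Let $<$ be any linear order on $\Omega$ satisfying one of the following, for all $i,j,k\in\mathbb N$: (i) $W_{-i}<\tilde G_{j+1}<W_{k+1}$; (ii) $W_{k+1}<\tilde G_{j+1}<W_{-i}$; (iii) $W_{k+1}<W_{-i}<\tilde G_{j+1}$; (iv) $W_{-i}<W_{k+1}<\tilde G_{j+1}$; (v) $\tilde G_{j+1}<W_{k+1}<W_{-i}$; (vi) $\tilde G_{j+1}<W_{-i}<W_{k+1}$. Then $\Omega$ with the order $<$ is a PBW basis for $U$. That is, the elements $a_1\star a_2\star\cdots\star a_n$, where $n\in\mathbb N$, $a_1,\ldots,a_n\in\Omega$ and $a_1\le a_2\le\cdots\le a_n$, form a basis for the vector space $U$. Here the empty product is interpreted as $1$.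
   Context: Let $\mathbb F$ be a field and let $q\in\mathbb F$ be nonzero and not a root of unity. Let $\mathbb V$ be the free associative $\mathbb F$-algebra on noncommuting generators $x,y$. The words in $x,y$, including the empty word $1$, form a basis of $\mathbb V$. Juxtaposition denotes concatenation of words (the free product). Set $\langle x,x\rangle=\langle y,y\rangle=2$ and $\langle x,y\rangle=\langle y,x\rangle=-2$. The $q$-shuffle product $\star$ on $\mathbb V$ is the bilinear product determined as follows: - $1\star v=v\star 1=v$; - for nontrivial words $u=u_1\cdots u_r$ and $v=v_1\cdots v_s$ (with letters $u_i,v_j$), $$u\star v=u_1\big((u_2\cdots u_r)\star v\big)+v_1\big(u\star (v_2\cdots v_s)\big)\,q^{\langle u_1,v_1\rangle+\langle u_2,v_1\rangle+\cdots+\langle u_r,v_1\rangle}.$$ With this product, $\mathbb V$ is an associative algebra with identity $1$, called the $q$-shuffle algebra. Alternating words: for $k\in\mathbb N$, - $W_{-k}=xyxy\cdots x$ is the alternating word of length $2k+1$ that begins and ends with $x$ (so $W_0=x$, $W_{-1}=xyx$); - $W_{k+1}=yxyx\cdots y$ is the alternating word of length $2k+1$ that begins and ends with $y$ (so $W_1=y$, $W_2=yxy$); - $\tilde G_k=xyxy\cdots xy$ is the word of length $2k$ (so $\tilde G_1=xy$), with $\tilde G_0=1$. *)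

theory Defs
  imports Main
begin

datatype letter = X | Y

type_synonym word = "letter list"

text \<open>An element of V is a finitely supported function word => F (the coefficient
  of each word). Elements of V are the functions in vspace.\<close>

definition vspace :: "(word \<Rightarrow> 'a::field) set" where
  "vspace = {f. finite {w. f w \<noteq> 0}}"

definition supp :: "(word \<Rightarrow> 'a::field) \<Rightarrow> word set" where
  "supp f = {w. f w \<noteq> 0}"

definition wsingle :: "word \<Rightarrow> 'a::field \<Rightarrow> (word \<Rightarrow> 'a)" where
  "wsingle v c = (\<lambda>w. if w = v then c else 0)"

definition vplus :: "(word \<Rightarrow> 'a::field) \<Rightarrow> (word \<Rightarrow> 'a) \<Rightarrow> (word \<Rightarrow> 'a)" where
  "vplus f g = (\<lambda>w. f w + g w)"

definition vscale :: "'a::field \<Rightarrow> (word \<Rightarrow> 'a) \<Rightarrow> (word \<Rightarrow> 'a)" where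
  "vscale c f = (\<lambda>w. c * f w)"

definition vprepend :: "letter \<Rightarrow> (word \<Rightarrow> 'a::field) \<Rightarrow> (word \<Rightarrow> 'a)" where
  "vprepend a f = (\<lambda>w. case w of [] \<Rightarrow> 0 | c # w' \<Rightarrow> if c = a then f w' else 0)"

definition lpair :: "letter \<Rightarrow> letter \<Rightarrow> int" where
  "lpair a b = (if a = b then 2 else -2)"

fun wshuffle :: "'a::field \<Rightarrow> word \<Rightarrow> word \<Rightarrow> (word \<Rightarrow> 'a)" where
  "wshuffle q [] v = wsingle v 1"
| "wshuffle q u [] = wsingle u 1"
| "wshuffle q (a # u) (b # v) =
     vplus (vprepend a (wshuffle q u (b # v)))
           (vscale (q powi (\<Sum>c\<leftarrow>a # u. lpair c b)) (vprepend b (wshuffle q (a # u) v)))"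

definition qstar :: "'a::field \<Rightarrow> (word \<Rightarrow> 'a) \<Rightarrow> (word \<Rightarrow> 'a) \<Rightarrow> (word \<Rightarrow> 'a)" where
  "qstar q f g = (\<lambda>w. \<Sum>u\<in>supp f. \<Sum>v\<in>supp g. f u * g v * wshuffle q u v w)"

definition vone :: "word \<Rightarrow> 'a::field" where
  "vone = wsingle [] 1"

definition vx :: "word \<Rightarrow> 'a::field" where
  "vx = wsingle [X] 1"

definition vy :: "word \<Rightarrow> 'a::field" where
  "vy = wsingle [Y] 1"

inductive_set Ualg :: "'a::field \<Rightarrow> (word \<Rightarrow> 'a) set" for q :: 'a where
  one: "vone \<in> Ualg q"
| gx: "vx \<in> Ualg q"
| gy: "vy \<in> Ualg q"
| add: "f \<in> Ualg q \<Longrightarrow> g \<in> Ualg q \<Longrightarrow> vplus f g \<in> Ualg q"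
| scale: "f \<in> Ualg q \<Longrightarrow> vscale c f \<in> Ualg q"
| mult: "f \<in> Ualg q \<Longrightarrow> g \<in> Ualg q \<Longrightarrow> qstar q f g \<in> Ualg q"

fun other :: "letter \<Rightarrow> letter" where
  "other X = Y" | "other Y = X"

fun alt :: "letter \<Rightarrow> nat \<Rightarrow> word" where
  "alt a 0 = []"
| "alt a (Suc n) = a # alt (other a) n"

text \<open>Index set for Omega: Wneg i = W_{-i}, Gt j = tilde G_{j+1}, Wpos k = W_{k+1}.\<close>
datatype omega = Wneg nat | Gt nat | Wpos nat

fun omega_word :: "omega \<Rightarrow> word" where
  "omega_word (Wneg i) = alt X (2 * i + 1)"
| "omega_word (Gt j) = alt X (2 * j + 2)"
| "omega_word (Wpos k) = alt Y (2 * k + 1)"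

definition omega_elt :: "omega \<Rightarrow> (word \<Rightarrow> 'a::field)" where
  "omega_elt a = wsingle (omega_word a) 1"

definition omega_prod :: "'a::field \<Rightarrow> omega list \<Rightarrow> (word \<Rightarrow> 'a)" where
  "omega_prod q as = foldr (\<lambda>a acc. qstar q (omega_elt a) acc) as vone"

definition linear_order_rel :: "(omega \<Rightarrow> omega \<Rightarrow> bool) \<Rightarrow> bool" where
  "linear_order_rel le \<longleftrightarrow>
     (\<forall>a. le a a) \<and> (\<forall>a b. le a b \<and> le b a \<longrightarrow> a = b) \<and>
     (\<forall>a b c. le a b \<and> le b c \<longrightarrow> le a c) \<and> (\<forall>a b. le a b \<or> le b a)"

definition strict_of :: "(omega \<Rightarrow> omega \<Rightarrow> bool) \<Rightarrow> omega \<Rightarrow> omega \<Rightarrow> bool" where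
  "strict_of le a b \<longleftrightarrow> le a b \<and> a \<noteq> b"

definition admissible_order :: "(omega \<Rightarrow> omega \<Rightarrow> bool) \<Rightarrow> bool" where
  "admissible_order le \<longleftrightarrow> (let lt = strict_of le in
     (\<forall>i j k. lt (Wneg i) (Gt j) \<and> lt (Gt j) (Wpos k)) \<or>
     (\<forall>i j k. lt (Wpos k) (Gt j) \<and> lt (Gt j) (Wneg i)) \<or>
     (\<forall>i j k. lt (Wpos k) (Wneg i) \<and> lt (Wneg i) (Gt j)) \<or>
     (\<forall>i j k. lt (Wneg i) (Wpos k) \<and> lt (Wpos k) (Gt j)) \<or>
     (\<forall>i j k. lt (Gt j) (Wpos k) \<and> lt (Wpos k) (Wneg i)) \<or>
     (\<forall>i j k. lt (Gt j) (Wneg i) \<and> lt (Wneg i) (Wpos k)))"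

definition is_basis_family :: "('i \<Rightarrow> (word \<Rightarrow> 'a::field)) \<Rightarrow> 'i set \<Rightarrow> (word \<Rightarrow> 'a) set \<Rightarrow> bool" where
  "is_basis_family b I S \<longleftrightarrow>
     (\<forall>i\<in>I. b i \<in> S) \<and>
     (\<forall>F c. finite F \<longrightarrow> F \<subseteq> I \<longrightarrow> (\<forall>w. (\<Sum>i\<in>F. c i * b i w) = 0) \<longrightarrow> (\<forall>i\<in>F. c i = 0)) \<and>
     (\<forall>f\<in>S. \<exists>F c. finite F \<and> F \<subseteq> I \<and> (\<forall>w. f w = (\<Sum>i\<in>F. c i * b i w)))"

end

(* Write W+(t), W-(t), G~(t) for the generating functions of the three families, and call the
   number of y minus the number of x in a word its defect.

   Left deletion of a letter is a skew derivation of the q-shuffle algebra and maps alternating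
   words to alternating words, so the quadratic relations between alternating words follow by
   induction on length. These relations put all alternating words into U. For spanning, let M be
   the span of the products (W-)*(G~)*(W+)*. Moving y past W- only creates even alternating words,
   and those starting with y are eliminated by the relation expressing
   sum_k q^(-2k) G_k G~_(n-k) through products W- W+; hence M is stable under left multiplication
   by x and y and contains U. Exchange relations between odd and even words, and the passage from
   q to 1/q (which reverses products up to a scalar), give the other five orders.

   For independence it suffices to find in U an independent family with as many elements of each
   length as there are ordered monomials. Let E(t) G~(t) = W+(t). Every proper prefix of a word in
   E_n has defect at most 0. Hence deleting a prefix of maximal defect and minimal length separates
   the factors E_n from products of alternating words starting with x, and deleting a prefix from
   the support of E_n, n minimal, separates products of the E_n. Products of alternating words
   starting with the same letter are separated by deleting that letter as often as possible; this
   works in every characteristic since only q-factorials occur. *)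

theory Submission
  imports Defs "HOL.Vector_Spaces" "HOL-Library.Function_Algebras" "HOL-Library.Multiset"
begin

section \<open>Coefficientwise description of the q-shuffle product\<close>

text \<open>No dimension of \<open>U\<close> is known in advance. Spanning bounds each length
  component of \<open>U\<close> from above by the number of ordered monomials, and one explicit
  independent family of that size closes the count for all six orders at once. The obstacle is that
  the words W_{k+1} themselves cannot serve in that family: each of them has defect 1 already after
  its first letter, so a short prefix of maximal defect does not reveal how long the factors were.
  Dividing W+(t) by G~(t) repairs this, at the price that the quotient consists of linear
  combinations of words, known only through a recursion for their deletions. That \<open>q\<close>
  is not a root of unity enters through a few scalars: \<open>1 - q^(-2)\<close> and
  \<open>1 + q^(-2n)\<close> when alternating words are generated from the letters,
  \<open>1 + q^2\<close> in a coefficient of E_n, and geometric sums in \<open>q^2\<close> or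
  \<open>q^(-2)\<close> that count equal or parallel factors.\<close>

fun dg :: "letter \<Rightarrow> int" where
  "dg X = -1" | "dg Y = 1"

definition defect :: "word \<Rightarrow> int" where
  "defect w = (\<Sum>c\<leftarrow>w. dg c)"

definition dl :: "letter \<Rightarrow> (word \<Rightarrow> 'a::field) \<Rightarrow> word \<Rightarrow> 'a" where
  "dl a f = (\<lambda>w. f (a # w))"

definition dr :: "letter \<Rightarrow> (word \<Rightarrow> 'a::field) \<Rightarrow> word \<Rightarrow> 'a" where
  "dr a f = (\<lambda>w. f (w @ [a]))"

definition ld :: "word \<Rightarrow> (word \<Rightarrow> 'a::field) \<Rightarrow> word \<Rightarrow> 'a" where
  "ld u f = (\<lambda>w. f (u @ w))"

definition revf :: "(word \<Rightarrow> 'a::field) \<Rightarrow> word \<Rightarrow> 'a" where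
  "revf f = (\<lambda>w. f (rev w))"

text \<open>Since \<open>lpair a b = 2 * dg a * dg b\<close>, the twist by \<open>z = dg b\<close>
  multiplies a word by the power of \<open>q\<close> that arises when the letter \<open>b\<close>
  moves to the left past the whole word.\<close>

definition tw :: "'a::field \<Rightarrow> int \<Rightarrow> (word \<Rightarrow> 'a) \<Rightarrow> word \<Rightarrow> 'a" where
  "tw q z f = (\<lambda>u. q powi (2 * defect u * z) * f u)"

text \<open>Left deletion of a letter is a skew derivation for the q-shuffle product. Read as a
  recursion on the word at which a product is evaluated, this rule defines the product of
  arbitrary functions on words, without any support condition.\<close>

fun star :: "'a::field \<Rightarrow> (word \<Rightarrow> 'a) \<Rightarrow> (word \<Rightarrow> 'a) \<Rightarrow> word \<Rightarrow> 'a" where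
  "star q f g [] = f [] * g []"
| "star q f g (a # w) = star q (dl a f) g w + star q (tw q (dg a) f) (dl a g) w"

lemma defect_simps [simp]:
  "defect [] = 0" "defect (a # u) = dg a + defect u" "defect (u @ v) = defect u + defect v"
  by (simp_all add: defect_def)

lemma defect_rev [simp]: "defect (rev u) = defect u"
  by (induction u) auto

lemma lpair_dg: "lpair a b = 2 * dg a * dg b"
  by (cases a; cases b) (auto simp: lpair_def)

lemma sum_lpair_Cons: "lpair a b + (\<Sum>c\<leftarrow>u. lpair c b) = 2 * defect (a # u) * dg b"
  by (induction u) (auto simp: lpair_dg algebra_simps)

lemma vplus_plus: "vplus f g = f + g"
  by (auto simp: vplus_def)

lemma vscale_apply: "vscale c f w = c * f w"
  by (simp add: vscale_def)

lemma vone_apply: "vone w = (if w = [] then 1 else 0)"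
  by (simp add: vone_def wsingle_def)

lemmas pointwise = plus_fun_apply zero_fun_apply minus_apply uminus_apply vscale_apply vone_apply

(* The induction method eta-expands function-valued terms, so evaluating them pointwise by
   default would destroy the structure of products. *)
declare plus_fun_apply [simp del] zero_fun_apply [simp del] minus_apply [simp del]
  uminus_apply [simp del]

interpretation fs: vector_space "vscale :: 'a::field \<Rightarrow> (word \<Rightarrow> 'a) \<Rightarrow> (word \<Rightarrow> 'a)"
  by unfold_locales (auto simp: fun_eq_iff pointwise algebra_simps)

lemma sum_apply: "(sum f A) w = (\<Sum>i\<in>A. f i w)" for f :: "'i \<Rightarrow> word \<Rightarrow> 'a::field"
  by (induction A rule: infinite_finite_induct) (auto simp: pointwise)

lemma word_fun_eqI:
  assumes "f [] = g []" "\<And>a. dl a f = dl a g"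
  shows "f = g"
proof
  fix w show "f w = g w"
    using assms by (cases w) (auto simp: dl_def fun_eq_iff)
qed

lemma word_fun_eqI2:
  assumes "f [] = g []" "dl a f = dl a g" "dl (other a) f = dl (other a) g"
  shows "f = g"
proof (rule word_fun_eqI)
  fix b show "dl b f = dl b g"
    using assms(2,3) by (cases a; cases b) auto
qed (rule assms(1))

lemma dl_simps [simp]:
  "dl a (f + g) = dl a f + dl a g" "dl a (f - g) = dl a f - dl a g" "dl a (- f) = - dl a f"
  "dl a 0 = 0" "dl a (vscale c f) = vscale c (dl a f)" "dl a vone = 0"
  "dl a (vprepend b f) = (if a = b then f else 0)"
  "dl a (star q f g) = star q (dl a f) g + star q (tw q (dg a) f) (dl a g)"
  by (auto simp: dl_def fun_eq_iff pointwise vprepend_def)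

lemma dl_sum [simp]: "dl a (sum f A) = (\<Sum>i\<in>A. dl a (f i))" for f :: "'i \<Rightarrow> word \<Rightarrow> 'a::field"
  using sum_comp_morphism[of "dl a" f A] by (simp add: o_def)

lemma vprepend_Nil [simp]: "vprepend a f [] = 0"
  by (simp add: vprepend_def)

lemma tw_simps [simp]:
  "tw q z (f + g) = tw q z f + tw q z g" "tw q z (f - g) = tw q z f - tw q z g"
  "tw q z 0 = 0" "tw q z (vscale c f) = vscale c (tw q z f)" "tw q z f [] = f []"
  "tw q 0 f = f"
  by (auto simp: tw_def fun_eq_iff pointwise algebra_simps)

lemma tw_vone [simp]: "tw q z vone = vone"
  by (auto simp: tw_def fun_eq_iff pointwise)

lemma tw_tw: "q \<noteq> 0 \<Longrightarrow> tw q y (tw q z f) = tw q (y + z) f"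
  by (auto simp: tw_def fun_eq_iff pointwise algebra_simps power_int_add)

lemma dl_tw: "q \<noteq> 0 \<Longrightarrow> dl a (tw q z f) = vscale (q powi (2 * dg a * z)) (tw q z (dl a f))"
  by (auto simp: tw_def dl_def fun_eq_iff pointwise algebra_simps power_int_add)

lemma tw_eq_0_iff: "q \<noteq> 0 \<Longrightarrow> tw q z f = 0 \<longleftrightarrow> f = 0"
  by (auto simp: tw_def fun_eq_iff pointwise)

lemma star_add_left: "star q (f + f') g w = star q f g w + star q f' g w"
  by (induction w arbitrary: f f' g) (auto simp: algebra_simps pointwise)

lemma star_add_right: "star q f (g + g') w = star q f g w + star q f g' w"
  by (induction w arbitrary: f g g') (auto simp: algebra_simps pointwise)

lemma star_scale_left: "star q (vscale c f) g w = c * star q f g w"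
  by (induction w arbitrary: f g) (auto simp: algebra_simps pointwise)

lemma star_scale_right: "star q f (vscale c g) w = c * star q f g w"
  by (induction w arbitrary: f g) (auto simp: algebra_simps pointwise)

lemma star_zero_left_apply: "star q 0 g w = 0"
  by (induction w arbitrary: g) (auto simp: pointwise)

lemma star_zero_right_apply: "star q f 0 w = 0"
  by (induction w arbitrary: f) (auto simp: pointwise)

lemma star_one_left_apply: "star q vone g w = g w"
proof (induction w arbitrary: g)
  case (Cons a w)
  then show ?case by (simp add: star_zero_left_apply plus_fun_apply) (simp add: dl_def zero_fun_apply)
qed (simp add: pointwise)

lemma star_one_right_apply: "star q f vone w = f w"
proof (induction w arbitrary: f)
  case (Cons a w)
  then show ?case by (simp add: star_zero_right_apply plus_fun_apply) (simp add: dl_def)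
qed (simp add: pointwise)

lemma star_linear [simp]:
  "star q 0 g = 0" "star q f 0 = 0" "star q vone g = g" "star q f vone = f"
  "star q (f + f') g = star q f g + star q f' g" "star q f (g + g') = star q f g + star q f g'"
  "star q (vscale c f) g = vscale c (star q f g)" "star q f (vscale c g) = vscale c (star q f g)"
  by (auto simp: fun_eq_iff pointwise star_add_left star_add_right star_scale_left star_scale_right
      pointwise
      star_zero_left_apply star_zero_right_apply star_one_left_apply star_one_right_apply)

lemma uminus_vscale: "- f = vscale (- 1) f"
  by (auto simp: fun_eq_iff pointwise)

lemma star_minus [simp]:
  "star q (- f) g = - star q f g" "star q f (- g) = - star q f g"
  "star q (f - f') g = star q f g - star q f' g" "star q f (g - g') = star q f g - star q f g'"
proof -
  show 1: "star q (- f) g = - star q f g" for f g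
    by (simp only: uminus_vscale star_linear)
  show 2: "star q f (- g) = - star q f g" for f g
    by (simp only: uminus_vscale star_linear)
  show "star q (f - f') g = star q f g - star q f' g"
    using star_linear(5)[of q f "- f'" g] 1 by simp
  show "star q f (g - g') = star q f g - star q f g'"
    using star_linear(6)[of q f g "- g'"] 2 by simp
qed

lemma star_sum_left: "star q (sum f A) g = (\<Sum>i\<in>A. star q (f i) g)"
  using sum_comp_morphism[of "\<lambda>h. star q h g" f A] by (simp add: o_def)

lemma star_sum_right: "star q f (sum g A) = (\<Sum>i\<in>A. star q f (g i))"
  using sum_comp_morphism[of "star q f" g A] by (simp add: o_def)

text \<open>Defects add under shuffling, so a twist is an automorphism of the product. This makes
  the skew derivation rule compatible with iterated products and is the substance of
  associativity.\<close>

lemma tw_star: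
  assumes "q \<noteq> 0"
  shows "tw q z (star q f g) = star q (tw q z f) (tw q z g)"
proof
  fix w show "tw q z (star q f g) w = star q (tw q z f) (tw q z g) w"
  proof (induction w arbitrary: f g)
    case (Cons a w)
    have "tw q z (star q f g) (a # w)
      = q powi (2 * dg a * z) * tw q z (star q (dl a f) g) w
      + q powi (2 * dg a * z) * tw q z (star q (tw q (dg a) f) (dl a g)) w"
      using assms by (simp add: tw_def power_int_add algebra_simps pointwise)
    then show ?case
      using assms Cons.IH by (simp add: dl_tw tw_tw add.commute pointwise)
  qed (simp add: tw_def)
qed

lemma star_assoc:
  assumes "q \<noteq> 0"
  shows "star q (star q f g) h = star q f (star q g h)"
proof
  fix w show "star q (star q f g) h w = star q f (star q g h) w"
    by (induction w arbitrary: f g h) (simp_all add: assms tw_star pointwise)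
qed

text \<open>A last letter that comes from the left factor has been passed by every letter of the
  right factor, so for deletion at the right end the twist falls on \<open>g\<close>.\<close>

lemma star_snoc:
  assumes "q \<noteq> 0"
  shows "star q f g (w @ [a]) = star q f (dr a g) w + star q (dr a f) (tw q (dg a) g) w"
proof (induction w arbitrary: f g)
  case Nil
  show ?case by (simp add: dl_def dr_def)
next
  case (Cons c w)
  have "dr a (tw q (dg c) f) = vscale (q powi (2 * dg a * dg c)) (tw q (dg c) (dr a f))"
    using assms by (auto simp: tw_def dr_def fun_eq_iff pointwise algebra_simps power_int_add)
  moreover have "dr a (dl c f) = dl c (dr a f)" for f :: "word \<Rightarrow> 'a"
    by (simp add: dr_def dl_def)
  ultimately show ?case
    by (simp add: Cons.IH dl_tw[OF assms] plus_fun_apply mult.commute mult.left_commute)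
qed

text \<open>Reversal interchanges the two deletion rules and hence the two factors, with the same
  \<open>q\<close>. It later carries relations for even words with one first letter over to the
  other first letter.\<close>

lemma revf_star:
  assumes "q \<noteq> 0"
  shows "revf (star q f g) = star q (revf g) (revf f)"
proof
  fix w show "revf (star q f g) w = star q (revf g) (revf f) w"
  proof (induction w arbitrary: f g)
    case (Cons a w)
    have 1: "revf (dr a h) = dl a (revf h)" "revf (tw q (dg a) h) = tw q (dg a) (revf h)"
      for h :: "word \<Rightarrow> 'a"
      by (auto simp: revf_def dr_def dl_def tw_def fun_eq_iff pointwise)
    have "revf (star q f g) (a # w)
        = revf (star q f (dr a g)) w + revf (star q (dr a f) (tw q (dg a) g)) w"
      by (simp add: revf_def star_snoc[OF assms])
    then show ?case by (simp add: Cons.IH 1 pointwise)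
  qed (simp add: revf_def)
qed

lemma revf_simps [simp]:
  "revf (f + g) = revf f + revf g" "revf (f - g) = revf f - revf g"
  "revf (vscale c f) = vscale c (revf f)" "revf (revf f) = f"
  by (auto simp: revf_def fun_eq_iff pointwise)

lemma wsingle_dl [simp]:
  "dl a (wsingle [] c) = 0" "dl a (wsingle (b # u) c) = (if a = b then wsingle u c else 0)"
  by (auto simp: dl_def wsingle_def fun_eq_iff pointwise)

lemma tw_wsingle: "tw q z (wsingle u c) = vscale (q powi (2 * defect u * z)) (wsingle u c)"
  by (auto simp: tw_def wsingle_def fun_eq_iff pointwise)

lemma wshuffle_star: "wshuffle q u v = star q (wsingle u 1) (wsingle v 1)"
proof (induction q u v rule: wshuffle.induct)
  case (3 q a u b v)
  show ?case
  proof (rule word_fun_eqI)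
    show "wshuffle q (a # u) (b # v) [] = star q (wsingle (a # u) 1) (wsingle (b # v) 1) []"
      by (simp add: vplus_plus wsingle_def pointwise)
    fix c
    show "dl c (wshuffle q (a # u) (b # v)) = dl c (star q (wsingle (a # u) 1) (wsingle (b # v) 1))"
      using 3 by (auto simp: vplus_plus sum_lpair_Cons tw_wsingle)
  qed
qed (simp_all flip: vone_def)

lemma fin_expand:
  assumes "finite (supp f)"
  shows "f = (\<Sum>u\<in>supp f. vscale (f u) (wsingle u 1))"
proof
  fix w
  have "(\<Sum>u\<in>supp f. f u * wsingle u 1 w) = (\<Sum>u\<in>supp f. if u = w then f u else 0)"
    by (intro sum.cong) (auto simp: wsingle_def)
  also have "\<dots> = f w"
    using assms by (auto simp: supp_def)
  finally show "f w = (\<Sum>u\<in>supp f. vscale (f u) (wsingle u 1)) w"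
    by (simp add: sum_apply pointwise)
qed

lemma qstar_star:
  assumes "finite (supp f)" "finite (supp g)"
  shows "qstar q f g = star q f g"
proof -
  have "star q f g = star q (\<Sum>u\<in>supp f. vscale (f u) (wsingle u 1)) (\<Sum>v\<in>supp g. vscale (g v) (wsingle v 1))"
    using fin_expand[OF assms(1)] fin_expand[OF assms(2)] by simp
  also have "\<dots> = (\<Sum>u\<in>supp f. \<Sum>v\<in>supp g. vscale (f u * g v) (wshuffle q u v))"
    unfolding star_sum_left unfolding star_sum_right by (simp add: wshuffle_star mult.commute)
  also have "\<dots> = qstar q f g"
    by (auto simp: qstar_def sum_apply pointwise)
  finally show ?thesis by simp
qed

lemma finite_supp_add: "finite (supp f) \<Longrightarrow> finite (supp g) \<Longrightarrow> finite (supp (f + g))"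
  by (rule finite_subset[of _ "supp f \<union> supp g"]) (auto simp: supp_def pointwise)

lemma finite_supp_scale: "finite (supp f) \<Longrightarrow> finite (supp (vscale c f))"
  by (rule finite_subset[of _ "supp f"]) (auto simp: supp_def pointwise)

text \<open>Lengths are integers so that deleting a letter lowers the degree by one without side
  conditions. Zero has every bidegree, and a negative length forces zero.\<close>

definition homog :: "int \<Rightarrow> int \<Rightarrow> (word \<Rightarrow> 'a::field) \<Rightarrow> bool" where
  "homog l d f \<longleftrightarrow> (\<forall>w. f w \<noteq> 0 \<longrightarrow> int (length w) = l \<and> defect w = d)"

lemma homog_dl: "homog l d f \<Longrightarrow> homog (l - 1) (d - dg a) (dl a f)"
  by (force simp: homog_def dl_def)

lemma homog_tw: "homog l d f \<Longrightarrow> homog l d (tw q z f)"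
  by (simp add: homog_def tw_def)

lemma homog_tw_eq: "homog l d f \<Longrightarrow> tw q z f = vscale (q powi (2 * d * z)) f"
  by (force simp: homog_def tw_def fun_eq_iff pointwise)

lemma homog_star:
  assumes "homog l d f" "homog l' d' g"
  shows "homog (l + l') (d + d') (star q f g)"
proof -
  have "star q f g w \<noteq> 0 \<Longrightarrow> int (length w) = l + l' \<and> defect w = d + d'" for w
    using assms
  proof (induction w arbitrary: f g l d l' d')
    case (Cons a w)
    then consider "star q (dl a f) g w \<noteq> 0" | "star q (tw q (dg a) f) (dl a g) w \<noteq> 0"
      by (force simp: pointwise)
    then show ?case
    proof cases
      case 1
      from Cons.IH[OF this homog_dl[OF Cons.prems(2)] Cons.prems(3)] show ?thesis by simp
    next
      case 2
      from Cons.IH[OF this homog_tw[OF Cons.prems(2)] homog_dl[OF Cons.prems(3)]]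
      show ?thesis by simp
    qed
  qed (force simp: homog_def)
  then show ?thesis by (auto simp: homog_def)
qed

lemma homog_wsingle: "homog (int (length u)) (defect u) (wsingle u c)"
  by (simp add: homog_def wsingle_def)

lemma homog_vone: "homog 0 0 vone"
  by (simp add: homog_def pointwise)

lemma homog_scale: "homog l d f \<Longrightarrow> homog l d (vscale c f)"
  by (simp add: homog_def pointwise)

lemma homog_sum: "(\<And>i. i \<in> A \<Longrightarrow> homog l d (f i)) \<Longrightarrow> homog l d (sum f A)"
  unfolding homog_def by (simp add: sum_apply) (metis sum.neutral)

lemma homog_finite_supp:
  assumes "homog l d f"
  shows "finite (supp f)"
proof (rule finite_subset)
  have "set w \<subseteq> {X, Y}" for w
    using letter.exhaust by blast
  then show "supp f \<subseteq> {w. set w \<subseteq> {X, Y} \<and> length w = nat l}"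
    using assms by (auto simp: supp_def homog_def)
  show "finite {w. set w \<subseteq> {X, Y} \<and> length w = nat l}"
    by (rule finite_lists_length_eq) simp
qed

lemma finite_supp_star:
  assumes "finite (supp f)" "finite (supp g)"
  shows "finite (supp (star q f g))"
proof -
  have sum: "finite (supp (sum h A))" if "\<And>i. i \<in> A \<Longrightarrow> finite (supp (h i))" for h :: "word \<Rightarrow> word \<Rightarrow> 'a" and A
  proof (cases "finite A")
    case True
    have "supp (sum h A) \<subseteq> (\<Union>i\<in>A. supp (h i))"
      using sum.not_neutral_contains_not_neutral by (force simp: supp_def sum_apply)
    then show ?thesis using True that by (auto intro: finite_subset)
  qed (simp add: supp_def pointwise)
  have "star q f g = star q (\<Sum>u\<in>supp f. vscale (f u) (wsingle u 1)) (\<Sum>v\<in>supp g. vscale (g v) (wsingle v 1))"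
    using fin_expand[OF assms(1)] fin_expand[OF assms(2)] by simp
  also have "\<dots> = (\<Sum>u\<in>supp f. \<Sum>v\<in>supp g. vscale (f u * g v) (star q (wsingle u 1) (wsingle v 1)))"
    unfolding star_sum_left unfolding star_sum_right by (simp add: mult.commute)
  finally show ?thesis
    using homog_finite_supp[OF homog_star[OF homog_wsingle homog_wsingle]]
    by (simp only:) (intro sum finite_supp_scale)
qed

section \<open>Relations between alternating words\<close>

text \<open>Keeping the first letter as a parameter lets one statement serve both letters.
  \<open>aw X (2*k)\<close> is tilde G_k, \<open>aw X (2*k+1)\<close> is W_{-k},
  \<open>aw Y (2*k+1)\<close> is W_{k+1}; the words \<open>aw Y (2*k)\<close> with
  \<open>k > 0\<close> are the G_k, which do not belong to Omega.\<close>

definition aw :: "letter \<Rightarrow> nat \<Rightarrow> word \<Rightarrow> 'a::field" where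
  "aw a n = wsingle (alt a n) 1"

lemma other_simps [simp]: "other (other a) = a" "other a \<noteq> a" "a \<noteq> other a" "dg (other a) = - dg a"
  by (cases a; simp)+

lemma dg_sq [simp]: "dg a * dg a = 1" "dg a * (dg a * z) = z" "dg a * (z * dg a) = z"
  by (cases a; simp)+

lemma length_alt [simp]: "length (alt a n) = n"
  by (induction n arbitrary: a) auto

lemma defect_alt: "defect (alt a n) = (if even n then 0 else dg a)"
  by (induction n arbitrary: a) auto

lemma aw_0 [simp]: "aw a 0 = vone"
  by (simp add: aw_def vone_def)

lemma aw_Nil: "aw a n [] = (if n = 0 then 1 else 0)"
  by (cases n) (auto simp: aw_def wsingle_def)

lemma aw_Suc_Nil [simp]: "aw a (Suc n) [] = 0"
  by (simp add: aw_Nil)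

lemma vone_Nil [simp]: "vone [] = 1"
  by (simp add: vone_apply)

lemma dl_aw_Suc [simp]: "dl b (aw a (Suc n)) = (if b = a then aw (other a) n else 0)"
  by (simp add: aw_def)

lemma dl_aw_other [simp]: "dl a (aw (other a) n) = 0" "dl (other a) (aw a n) = 0"
  by (cases n; simp)+

lemma homog_aw: "homog (int n) (if even n then 0 else dg a) (aw a n)"
  using homog_wsingle[of "alt a n" 1] by (simp add: aw_def defect_alt)

lemma tw_aw_even [simp]: "tw q z (aw a (2 * k)) = aw a (2 * k)"
  using homog_tw_eq[OF homog_aw, of q z a "2 * k"] by simp

lemma tw_aw_even_SS [simp]: "tw q z (aw a (Suc (Suc (2 * k)))) = aw a (Suc (Suc (2 * k)))"
  using tw_aw_even[of q z a "Suc k"] by simp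

lemma tw_aw_odd [simp]:
  "tw q (dg a) (aw a (Suc (2 * k))) = vscale (q\<^sup>2) (aw a (Suc (2 * k)))"
  "tw q (- dg a) (aw a (Suc (2 * k))) = vscale (inverse (q\<^sup>2)) (aw a (Suc (2 * k)))"
  "tw q (dg a) (aw (other a) (Suc (2 * k))) = vscale (inverse (q\<^sup>2)) (aw (other a) (Suc (2 * k)))"
  using homog_tw_eq[OF homog_aw, of q "dg a" a "Suc (2 * k)"]
    homog_tw_eq[OF homog_aw, of q "- dg a" a "Suc (2 * k)"]
    homog_tw_eq[OF homog_aw, of q "dg a" "other a" "Suc (2 * k)"]
  by (simp_all add: mult.assoc power_int_minus)

lemma alt_snoc: "alt a (Suc n) = alt a n @ [if even n then a else other a]"
proof (induction n arbitrary: a)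
  case (Suc n)
  have "alt a (Suc (Suc n)) = a # alt (other a) (Suc n)" by simp
  also have "\<dots> = a # (alt (other a) n @ [if even n then other a else other (other a)])"
    by (simp only: Suc.IH)
  finally show ?case by simp
qed simp

lemma rev_alt: "rev (alt a n) = alt (if even n then other a else a) n"
proof (induction n arbitrary: a)
  case (Suc n)
  then show ?case by (subst alt_snoc) auto
qed simp

lemma revf_aw: "revf (aw a n) = aw (if even n then other a else a) n"
proof
  fix w
  have "rev w = alt a n \<longleftrightarrow> w = alt (if even n then other a else a) n"
    by (metis rev_alt rev_rev_ident)
  then show "revf (aw a n) w = aw (if even n then other a else a) n w"
    by (simp add: revf_def aw_def wsingle_def)
qed

lemma diff_eq_diff_iff: "x - y = z - w \<longleftrightarrow> x + w = z + y" for x y z w :: "'b::ab_group_add"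
  by (simp add: diff_eq_eq eq_diff_eq diff_add_eq)

locale qshuf =
  fixes q :: "'a::field"
  assumes q0: "q \<noteq> 0" and q_pow: "\<And>n::nat. n > 0 \<Longrightarrow> q ^ n \<noteq> 1"
begin

abbreviation st (infixl "\<star>" 70) where "f \<star> g \<equiv> star q f g"

lemmas assoc = star_assoc[OF q0]

lemma q2_ne_1: "q\<^sup>2 \<noteq> 1"
  by (rule q_pow) simp

lemma c_ne_0: "1 - inverse (q\<^sup>2) \<noteq> 0"
  using q2_ne_1 q0 by (simp add: field_simps)

text \<open>After deleting a letter, both sides consist of products of shorter words that agree once
  these commute as assumed. The step is needed inside the joint induction below and again
  afterwards, where it becomes \<open>odd_even_comm\<close>.\<close>

lemma alt_rel_step:
  assumes "aw a (Suc (2*k)) \<star> aw a (Suc (2*l)) = aw a (Suc (2*l)) \<star> aw a (Suc (2*k))"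
    and "aw (other a) (2*k) \<star> aw (other a) (2*Suc l) = aw (other a) (2*Suc l) \<star> aw (other a) (2*k)"
    and "aw (other a) (2*l) \<star> aw (other a) (2*Suc k) = aw (other a) (2*Suc k) \<star> aw (other a) (2*l)"
  shows "aw a (Suc (2*k)) \<star> aw (other a) (2*Suc l) - aw (other a) (2*Suc l) \<star> aw a (Suc (2*k))
       = aw a (Suc (2*l)) \<star> aw (other a) (2*Suc k) - aw (other a) (2*Suc k) \<star> aw a (Suc (2*l))"
  by (rule word_fun_eqI2[of _ _ a]) (use assms in \<open>simp_all add: pointwise\<close>)

text \<open>Deletion links the three relations, so they are proved together: commuting even words
  reduces to \<open>alt_rel_step\<close> with both indices lowered, the twisted relation to
  commuting even words with the same indices and commuting odd words with a smaller index sum, and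
  commuting odd words to the twisted relation. The factor \<open>q^2\<close> is the twist of an odd
  word by its own first letter.\<close>

lemma alt_rel:
  "aw (other a) (2*k) \<star> aw (other a) (2*l) = aw (other a) (2*l) \<star> aw (other a) (2*k)
   \<and> aw (other a) (2*k) \<star> aw a (Suc (2*l)) - vscale (q\<^sup>2) (aw a (Suc (2*l)) \<star> aw (other a) (2*k))
     = aw (other a) (2*l) \<star> aw a (Suc (2*k)) - vscale (q\<^sup>2) (aw a (Suc (2*k)) \<star> aw (other a) (2*l))
   \<and> aw a (Suc (2*k)) \<star> aw a (Suc (2*l)) = aw a (Suc (2*l)) \<star> aw a (Suc (2*k))"
    (is "?P2 k l \<and> ?P4 k l \<and> ?P1 k l")
proof (induction "k + l" arbitrary: k l rule: less_induct)
  case less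
  have P2: "?P2 k l"
  proof (cases "k = 0 \<or> l = 0")
    case False
    then obtain k' l' where kl: "k = Suc k'" "l = Suc l'" by (meson not0_implies_Suc)
    have P3: "aw a (Suc (2*k')) \<star> aw (other a) (2*Suc l') - aw (other a) (2*Suc l') \<star> aw a (Suc (2*k'))
       = aw a (Suc (2*l')) \<star> aw (other a) (2*Suc k') - aw (other a) (2*Suc k') \<star> aw a (Suc (2*l'))"
      by (rule alt_rel_step) (use less[of k' l'] less[of k' "Suc l'"] less[of l' "Suc k'"] kl in auto)
    show ?thesis unfolding kl
      by (rule word_fun_eqI2[of _ _ a]) (use P3 in \<open>simp_all add: pointwise diff_eq_diff_iff add.commute\<close>)
  qed auto
  have P1': "?P1 i j" if "i + j < k + l" for i j
    using less[OF that] by blast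
  have P4: "?P4 k l"
  proof (rule word_fun_eqI2[of _ _ a])
    have s: "inverse (q\<^sup>2) * q\<^sup>2 = 1" "q\<^sup>2 * inverse (q\<^sup>2) = 1"
      using q0 by simp_all
    have *: "dl (other a) (aw (other a) (2*i) \<star> aw a (Suc (2*j)) - vscale (q\<^sup>2) (aw a (Suc (2*j)) \<star> aw (other a) (2*i))) = 0"
      if "i + j = k + l" for i j
    proof (cases i)
      case (Suc i')
      then show ?thesis using P1'[of i' j] that by (simp add: s)
    qed simp
    show "dl (other a) (aw (other a) (2*k) \<star> aw a (Suc (2*l)) - vscale (q\<^sup>2) (aw a (Suc (2*l)) \<star> aw (other a) (2*k)))
      = dl (other a) (aw (other a) (2*l) \<star> aw a (Suc (2*k)) - vscale (q\<^sup>2) (aw a (Suc (2*k)) \<star> aw (other a) (2*l)))"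
      by (simp only: * add.commute[of l k])
    show "dl a (aw (other a) (2*k) \<star> aw a (Suc (2*l)) - vscale (q\<^sup>2) (aw a (Suc (2*l)) \<star> aw (other a) (2*k)))
      = dl a (aw (other a) (2*l) \<star> aw a (Suc (2*k)) - vscale (q\<^sup>2) (aw a (Suc (2*k)) \<star> aw (other a) (2*l)))"
      using P2 by simp
  qed (simp add: pointwise)
  have P1: "?P1 k l"
  proof (rule word_fun_eqI2[of _ _ a])
    show "dl a (aw a (Suc (2*k)) \<star> aw a (Suc (2*l))) = dl a (aw a (Suc (2*l)) \<star> aw a (Suc (2*k)))"
      using P4 by (simp add: diff_eq_diff_iff)
  qed simp_all
  show ?case using P1 P2 P4 by blast
qed

lemmas even_comm = alt_rel[THEN conjunct1]
lemmas odd_even_twisted = alt_rel[THEN conjunct2, THEN conjunct1]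
lemmas odd_comm = alt_rel[THEN conjunct2, THEN conjunct2]
lemmas odd_even_comm = alt_rel_step[OF odd_comm even_comm even_comm]

lemma even_comm': "aw a (2*k) \<star> aw a (2*l) = aw a (2*l) \<star> aw a (2*k)"
  using even_comm[of "other a"] by simp

lemma tw_letter:
  "tw q (dg a) (aw a (Suc 0)) = vscale (q\<^sup>2) (aw a (Suc 0))"
  "tw q (- dg a) (aw a (Suc 0)) = vscale (inverse (q\<^sup>2)) (aw a (Suc 0))"
  "tw q (dg a) (aw (other a) (Suc 0)) = vscale (inverse (q\<^sup>2)) (aw (other a) (Suc 0))"
  using tw_aw_odd[of q a 0] by simp_all

lemma vscale_one_minus: "vscale (1 - c) f = f - vscale c f"
  by (simp add: fs.scale_left_diff_distrib)

text \<open>The induction is a zigzag: \<open>?B (Suc k)\<close> comes from \<open>?A k\<close>, and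
  \<open>?A (Suc k)\<close> from \<open>?B (Suc k)\<close>. The constant \<open>p\<close> is the
  twist of a letter by the opposite letter. As \<open>1 - p\<close> is invertible, the relations
  produce longer alternating words from shorter ones.\<close>

lemma letter_odd:
  defines "p \<equiv> inverse (q\<^sup>2)"
  shows "aw (other a) (Suc 0) \<star> aw a (Suc (2*k)) - aw a (Suc (2*k)) \<star> aw (other a) (Suc 0)
     = vscale (1 - p) (aw (other a) (2*Suc k) - aw a (2*Suc k))
   \<and> aw (other a) (2*k) \<star> aw (other a) (Suc 0) - vscale p (aw (other a) (Suc 0) \<star> aw (other a) (2*k))
     = vscale (1 - p) (aw (other a) (Suc (2*k)))" (is "?A k \<and> ?B k")
proof (induction k)
  case 0
  have e: "aw b (2*Suc 0) = aw b (Suc (Suc 0))" for b :: letter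
    by (simp add: numeral_2_eq_2)
  have A: "?A 0"
    unfolding e
  proof (rule word_fun_eqI2[of _ _ a])
    show "dl a (aw (other a) (Suc 0) \<star> aw a (Suc (2*0)) - aw a (Suc (2*0)) \<star> aw (other a) (Suc 0))
        = dl a (vscale (1 - p) (aw (other a) (Suc (Suc 0)) - aw a (Suc (Suc 0))))"
      by (simp add: tw_letter vscale_one_minus flip: p_def)
    show "dl (other a) (aw (other a) (Suc 0) \<star> aw a (Suc (2*0)) - aw a (Suc (2*0)) \<star> aw (other a) (Suc 0))
        = dl (other a) (vscale (1 - p) (aw (other a) (Suc (Suc 0)) - aw a (Suc (Suc 0))))"
      by (simp add: tw_letter vscale_one_minus flip: p_def)
  qed (simp add: pointwise)
  have "?B 0" by (simp add: vscale_one_minus)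
  with A show ?case by blast
next
  case (Suc k)
  have s: "p * q\<^sup>2 = 1" "q\<^sup>2 * p = 1"
    using q0 by (simp_all add: p_def)
  have t: "tw q (- dg a) (aw a (Suc (2 * k))) = vscale p (aw a (Suc (2 * k)))" for a k
    by (simp add: p_def)
  have t2: "tw q (dg a) (aw (other a) (Suc (2 * k))) = vscale p (aw (other a) (Suc (2 * k)))" for a k
    by (simp add: p_def)
  have t': "tw q (- dg a) (aw a (Suc (Suc (Suc (2 * k))))) = vscale p (aw a (Suc (Suc (Suc (2 * k)))))" for a k
    using t[of a "Suc k"] by simp
  note t'' = tw_letter[folded p_def]
  have B: "?B (Suc k)"
  proof (rule word_fun_eqI2[of _ _ a])
    have A: "aw a (Suc (2*k)) \<star> aw (other a) (Suc 0)
        = aw (other a) (Suc 0) \<star> aw a (Suc (2*k)) - vscale (1 - p) (aw (other a) (2*Suc k) - aw a (2*Suc k))"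
      using Suc by (metis diff_diff_eq2 add_diff_cancel_left')
    show "dl (other a) (aw (other a) (2*Suc k) \<star> aw (other a) (Suc 0)
         - vscale p (aw (other a) (Suc 0) \<star> aw (other a) (2*Suc k)))
      = dl (other a) (vscale (1 - p) (aw (other a) (Suc (2*Suc k))))"
      using tw_letter(1)[of "other a"]
      by (simp add: A s vscale_one_minus fs.scale_right_diff_distrib fs.scale_right_distrib)
    show "dl a (aw (other a) (2*Suc k) \<star> aw (other a) (Suc 0)
         - vscale p (aw (other a) (Suc 0) \<star> aw (other a) (2*Suc k)))
      = dl a (vscale (1 - p) (aw (other a) (Suc (2*Suc k))))"
      by simp
  qed (simp add: pointwise)
  have "?A (Suc k)"
  proof (rule word_fun_eqI2[of _ _ a])
    have B': "aw (other a) (2*Suc k) \<star> aw (other a) (Suc 0)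
        = vscale p (aw (other a) (Suc 0) \<star> aw (other a) (2*Suc k)) + vscale (1 - p) (aw (other a) (Suc (2*Suc k)))"
      using B by (simp only: diff_eq_eq add.commute)
    show "dl a (aw (other a) (Suc 0) \<star> aw a (Suc (2*Suc k)) - aw a (Suc (2*Suc k)) \<star> aw (other a) (Suc 0))
      = dl a (vscale (1 - p) (aw (other a) (2*Suc (Suc k)) - aw a (2*Suc (Suc k))))"
      using B' by (simp add: t'' vscale_one_minus)
    show "dl (other a) (aw (other a) (Suc 0) \<star> aw a (Suc (2*Suc k)) - aw a (Suc (2*Suc k)) \<star> aw (other a) (Suc 0))
      = dl (other a) (vscale (1 - p) (aw (other a) (2*Suc (Suc k)) - aw a (2*Suc (Suc k))))"
      by (simp add: t' vscale_one_minus)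
  qed (simp_all add: pointwise)
  with B show ?case by blast
qed

lemmas letter_odd_comm = letter_odd[THEN conjunct1]
lemmas letter_even_comm = letter_odd[THEN conjunct2]

text \<open>Deleting \<open>X\<close> matches the two sums term by term. Deleting \<open>Y\<close>
  shifts the left sum by one index, while on the right \<open>Y\<close> passes an odd word starting
  with \<open>X\<close> at the cost of one factor \<open>q^(-2)\<close>; this forces the weights.
  For \<open>n = 0\<close> the left side would be \<open>vone\<close> and the right side 0.\<close>

lemma even_sum:
  assumes "n > 0"
  shows "(\<Sum>k\<le>n. vscale (inverse (q\<^sup>2) ^ k) (aw Y (2*k) \<star> aw X (2*(n-k))))
       = (\<Sum>k<n. vscale (inverse (q\<^sup>2) ^ k) (aw X (Suc (2*k)) \<star> aw Y (Suc (2*(n-k-1)))))"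
    (is "?L = ?R")
proof (rule word_fun_eqI2[of _ _ X])
  have "aw Y (2*k) [] * aw X (2*(n-k)) [] = (0::'a)" for k
    using assms by (cases "k = 0") (auto simp: aw_Nil)
  then show "?L [] = ?R []"
    by (auto simp: sum_apply pointwise intro!: sum.neutral)
next
  have Y: "dl X (aw Y k) = 0" "dl Y (aw X k) = 0" for k
    using dl_aw_other[of X k] by simp_all
  have "dl X ?L = (\<Sum>k\<le>n. vscale (inverse (q\<^sup>2) ^ k) (aw Y (2*k) \<star> dl X (aw X (2*(n-k)))))"
    by (simp add: Y)
  also have "\<dots> = (\<Sum>k<n. vscale (inverse (q\<^sup>2) ^ k) (aw Y (2*k) \<star> dl X (aw X (2*(n-k)))))"
    by (simp flip: lessThan_Suc_atMost)
  also have "\<dots> = (\<Sum>k<n. vscale (inverse (q\<^sup>2) ^ k) (aw Y (2*k) \<star> aw Y (Suc (2*(n-k-1)))))"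
  proof (rule sum.cong)
    fix k assume "k \<in> {..<n}"
    then have "2 * (n - k) = Suc (Suc (2 * (n-k-1)))" by auto
    then show "vscale (inverse (q\<^sup>2) ^ k) (aw Y (2*k) \<star> dl X (aw X (2*(n-k))))
      = vscale (inverse (q\<^sup>2) ^ k) (aw Y (2*k) \<star> aw Y (Suc (2*(n-k-1))))"
      by simp
  qed simp
  also have "\<dots> = dl X ?R"
    by (simp add: Y)
  finally show "dl X ?L = dl X ?R" .
  have "dl Y ?L = (\<Sum>k\<le>n. vscale (inverse (q\<^sup>2) ^ k) (dl Y (aw Y (2*k)) \<star> aw X (2*(n-k))))"
    by (simp add: Y)
  also have "\<dots> = (\<Sum>k<n. vscale (inverse (q\<^sup>2) ^ Suc k) (dl Y (aw Y (2*Suc k)) \<star> aw X (2*(n-Suc k))))"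
    by (subst sum.atMost_shift) simp
  also have "\<dots> = (\<Sum>k<n. vscale (inverse (q\<^sup>2) ^ k) (vscale (inverse (q\<^sup>2)) (aw X (Suc (2*k)) \<star> aw X (2*(n-k-1)))))"
    by (simp add: mult.commute)
  also have "\<dots> = dl Y ?R"
    using tw_aw_odd(2)[of q X] by (simp add: Y)
  finally show "dl (other X) ?L = dl (other X) ?R" by simp
qed

end

section \<open>The subalgebra generated by the letters\<close>

lemma add_diff_cancel_middle: "a + b + c - b = a + c" for a b c :: "'b::ab_group_add"
  by (simp add: algebra_simps)

lemma add_add_diff_cancel: "a + b + (c - a) = c + b" for a b c :: "'b::ab_group_add"
  by (simp add: algebra_simps)

lemma eq_diff_of_diff_eq: "a - b = c \<Longrightarrow> b = a - c" for a b c :: "'b::ab_group_add"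
  by (simp add: algebra_simps)

lemma eq_add_of_diff_eq: "a - b = c \<Longrightarrow> a = c + b" for a b c :: "'b::ab_group_add"
  by (simp add: algebra_simps)

lemma eq_diff_of_add_eq: "a + b = c \<Longrightarrow> b = c - a" for a b c :: "'b::ab_group_add"
  by (simp add: algebra_simps)

section \<open>Generated subalgebras and spans of ordered products\<close>

definition sprod :: "'a::field \<Rightarrow> (word \<Rightarrow> 'a) list \<Rightarrow> word \<Rightarrow> 'a" where
  "sprod q l = foldr (star q) l vone"

definition alg :: "'a::field \<Rightarrow> (word \<Rightarrow> 'a) set \<Rightarrow> (word \<Rightarrow> 'a) set" where
  "alg q S = fs.span (sprod q ` lists S)"

text \<open>Only a subspace, in general not closed under products: nested \<open>smul\<close> of
  \<open>alg\<close> records in which order the families of generators occur.\<close>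

definition smul :: "'a::field \<Rightarrow> (word \<Rightarrow> 'a) set \<Rightarrow> (word \<Rightarrow> 'a) set \<Rightarrow> (word \<Rightarrow> 'a) set" where
  "smul q A B = fs.span {star q f g | f g. f \<in> A \<and> g \<in> B}"

definition oddw :: "letter \<Rightarrow> (word \<Rightarrow> 'a::field) set" where
  "oddw a = range (\<lambda>k. aw a (Suc (2 * k)))"

definition evenw :: "letter \<Rightarrow> (word \<Rightarrow> 'a::field) set" where
  "evenw a = range (\<lambda>k. aw a (2 * k))"

lemma sprod_simps [simp]: "sprod q [] = vone" "sprod q (f # l) = star q f (sprod q l)"
  by (simp_all add: sprod_def)

lemma star_span_left:
  assumes "f \<in> fs.span S" "fs.subspace V" "\<And>s. s \<in> S \<Longrightarrow> star q s h \<in> V"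
  shows "star q f h \<in> V"
  using assms(1)
proof (induction rule: fs.span_induct_alt)
  case base
  then show ?case using assms(2) by (simp add: fs.subspace_0)
next
  case (step c x y)
  then show ?case using assms by (simp add: fs.subspace_add fs.subspace_scale)
qed

lemma star_span_right:
  assumes "f \<in> fs.span S" "fs.subspace V" "\<And>s. s \<in> S \<Longrightarrow> star q h s \<in> V"
  shows "star q h f \<in> V"
  using assms(1)
proof (induction rule: fs.span_induct_alt)
  case base
  then show ?case using assms(2) by (simp add: fs.subspace_0)
next
  case (step c x y)
  then show ?case using assms by (simp add: fs.subspace_add fs.subspace_scale)
qed

lemma smul_left:
  assumes "f \<in> smul q A B" "fs.subspace V" "\<And>a b. a \<in> A \<Longrightarrow> b \<in> B \<Longrightarrow> star q (star q a b) h \<in> V"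
  shows "star q f h \<in> V"
  by (rule star_span_left[OF assms(1)[unfolded smul_def] assms(2)]) (use assms(3) in blast)

lemma smul_right:
  assumes "f \<in> smul q A B" "fs.subspace V" "\<And>a b. a \<in> A \<Longrightarrow> b \<in> B \<Longrightarrow> star q h (star q a b) \<in> V"
  shows "star q h f \<in> V"
  by (rule star_span_right[OF assms(1)[unfolded smul_def] assms(2)]) (use assms(3) in blast)

lemma alg_right:
  assumes "f \<in> alg q S" "fs.subspace V" "\<And>l. l \<in> lists S \<Longrightarrow> star q h (sprod q l) \<in> V"
  shows "star q h f \<in> V"
  by (rule star_span_right[OF assms(1)[unfolded alg_def] assms(2)]) (use assms(3) in blast)

lemma alg_left:
  assumes "f \<in> alg q S" "fs.subspace V" "\<And>l. l \<in> lists S \<Longrightarrow> star q (sprod q l) h \<in> V"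
  shows "star q f h \<in> V"
  by (rule star_span_left[OF assms(1)[unfolded alg_def] assms(2)]) (use assms(3) in blast)

lemma smul_memI [intro]: "f \<in> A \<Longrightarrow> g \<in> B \<Longrightarrow> star q f g \<in> smul q A B"
  unfolding smul_def by (rule fs.span_base) blast

lemma smul_subspace [simp]: "fs.subspace (smul q A B)"
  by (simp add: smul_def)

lemma alg_subspace [simp]: "fs.subspace (alg q A)"
  by (simp add: alg_def)

lemma smul_subset: "fs.subspace V \<Longrightarrow> (\<And>a b. a \<in> A \<Longrightarrow> b \<in> B \<Longrightarrow> star q a b \<in> V) \<Longrightarrow> smul q A B \<subseteq> V"
  unfolding smul_def by (rule fs.span_minimal) auto

lemma sprod_alg: "l \<in> lists S \<Longrightarrow> sprod q l \<in> alg q S"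
  unfolding alg_def by (intro fs.span_base imageI)

lemma vone_alg [simp]: "vone \<in> alg q S"
  using sprod_alg[of "[]" S q] by simp

lemma gen_alg: "s \<in> S \<Longrightarrow> s \<in> alg q S"
  using sprod_alg[of "[s]" S q] by simp

lemma alg_gen_left:
  assumes "s \<in> S" "f \<in> alg q S"
  shows "star q s f \<in> alg q S"
proof (rule alg_right[OF assms(2)])
  fix l assume "l \<in> lists S"
  then show "star q s (sprod q l) \<in> alg q S"
    using sprod_alg[of "s # l" S q] assms(1) by simp
qed simp

text \<open>\<open>evenw\<close> contains the empty word, whereas the even words in Omega start with
  length 2; this reconciles the two conventions.\<close>

lemma alg_insert_vone: "alg q (insert vone S) = alg q S"
proof
  have "sprod q l \<in> alg q S" if "l \<in> lists (insert vone S)" for l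
    using that by (induction l) (auto intro: alg_gen_left)
  then show "alg q (insert vone S) \<subseteq> alg q S"
    unfolding alg_def[of q "insert vone S"] by (intro fs.span_minimal) auto
  show "alg q S \<subseteq> alg q (insert vone S)"
    unfolding alg_def by (intro fs.span_mono image_mono lists_mono) auto
qed

lemma Ualg_finite: "f \<in> Ualg q \<Longrightarrow> finite (supp f)"
proof (induction rule: Ualg.induct)
  case (mult f g)
  then show ?case using finite_supp_star by (simp add: qstar_star)
qed (auto simp: vx_def vy_def vplus_plus intro!: finite_supp_add finite_supp_scale
      homog_finite_supp[OF homog_wsingle] homog_finite_supp[OF homog_vone])

lemma Ualg_star: "f \<in> Ualg q \<Longrightarrow> g \<in> Ualg q \<Longrightarrow> star q f g \<in> Ualg q"
  using Ualg.mult[of f q g] by (simp add: qstar_star Ualg_finite)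

lemma Ualg_subspace: "fs.subspace (Ualg q)"
proof -
  have "vscale 0 vone \<in> Ualg q" by (intro Ualg.intros)
  moreover have "f + g \<in> Ualg q" if "f \<in> Ualg q" "g \<in> Ualg q" for f g
    using Ualg.add[OF that] by (simp add: vplus_plus)
  ultimately show ?thesis by (auto simp: fs.subspace_def intro: Ualg.scale)
qed

lemma Ualg_scaleD: "vscale c f \<in> Ualg q \<Longrightarrow> c \<noteq> 0 \<Longrightarrow> f \<in> Ualg q"
  using Ualg.scale[of "vscale c f" q "inverse c"] by simp

section \<open>Alternating words inside \<open>U\<close>, and exchange of odd and even words\<close>

context qshuf
begin

lemma sprod_append: "sprod q (l @ m) = sprod q l \<star> sprod q m"
  by (induction l) (simp_all add: assoc)

lemma alg_mult: "f \<in> alg q S \<Longrightarrow> g \<in> alg q S \<Longrightarrow> f \<star> g \<in> alg q S"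
proof (erule alg_left)
  fix l assume "l \<in> lists S" "g \<in> alg q S"
  then show "sprod q l \<star> g \<in> alg q S"
    by (induction l) (auto simp: assoc intro: alg_gen_left)
qed simp

lemma pow_inverse_ne: "1 + inverse (q\<^sup>2) ^ n \<noteq> 0" if "n > 0"
proof
  assume "1 + inverse (q\<^sup>2) ^ n = 0"
  then have "(inverse (q\<^sup>2) ^ n)\<^sup>2 = 1"
    by (simp add: add_eq_0_iff)
  moreover have "inverse (q ^ (2 * n * 2)) = (inverse (q\<^sup>2) ^ n)\<^sup>2"
    by (simp only: power_mult power_inverse)
  ultimately have "inverse (q ^ (2 * n * 2)) = 1" by simp
  then have "q ^ (2 * n * 2) = 1"
    by (metis inverse_1 inverse_inverse_eq)
  then show False using q_pow[of "2 * n * 2"] that by simp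
qed

text \<open>For \<open>n > 0\<close>, \<open>even_sum\<close> modulo shorter words puts
  \<open>aw X (2*n) + p^n aw Y (2*n)\<close> into \<open>U\<close>, and the commutator with a letter
  puts the difference of the two even words there. The determinant of this system is
  \<open>1 + p^n\<close>, nonzero by \<open>pow_inverse_ne\<close>. The odd words then follow from
  the even ones by \<open>letter_even_comm\<close>.\<close>

lemma aw_Ualg: "aw X (2*n) \<in> Ualg q \<and> aw Y (2*n) \<in> Ualg q
  \<and> aw X (Suc (2*n)) \<in> Ualg q \<and> aw Y (Suc (2*n)) \<in> Ualg q"
proof (induction n rule: less_induct)
  case (less n)
  note sub = fs.subspace_add[OF Ualg_subspace] fs.subspace_diff[OF Ualg_subspace]
    fs.subspace_sum[OF Ualg_subspace] Ualg.scale Ualg_star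
  have x: "aw X (Suc 0) \<in> Ualg q" and y: "aw Y (Suc 0) \<in> Ualg q"
    using Ualg.gx[of q] Ualg.gy[of q] by (simp_all add: aw_def vx_def vy_def)
  show ?case
  proof (cases n)
    case 0
    then show ?thesis using x y Ualg.one[of q] by simp
  next
    case (Suc m)
    define p where "p = inverse (q\<^sup>2)"
    have "(\<Sum>k<n. vscale (p ^ k) (aw X (Suc (2*k)) \<star> aw Y (Suc (2*(n-k-1))))) \<in> Ualg q"
      by (intro sub) (use less Suc in auto)
    then have "(\<Sum>k\<le>n. vscale (p ^ k) (aw Y (2*k) \<star> aw X (2*(n-k)))) \<in> Ualg q"
      using even_sum[of n] Suc by (simp add: p_def)
    also have "(\<Sum>k\<le>n. vscale (p ^ k) (aw Y (2*k) \<star> aw X (2*(n-k))))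
      = aw X (2*n) + (\<Sum>k<m. vscale (p ^ Suc k) (aw Y (2*Suc k) \<star> aw X (2*(n-Suc k)))) + vscale (p ^ n) (aw Y (2*n))"
      unfolding Suc sum.atMost_shift[of _ "Suc m"] sum.lessThan_Suc by (simp add: add.assoc del: mult_Suc_right power_Suc)
    finally have "aw X (2*n) + vscale (p ^ n) (aw Y (2*n)) \<in> Ualg q" (is "?s \<in> _")
    proof -
      assume a: "aw X (2*n) + (\<Sum>k<m. vscale (p ^ Suc k) (aw Y (2*Suc k) \<star> aw X (2*(n-Suc k)))) + vscale (p ^ n) (aw Y (2*n)) \<in> Ualg q"
      have "(\<Sum>k<m. vscale (p ^ Suc k) (aw Y (2*Suc k) \<star> aw X (2*(n-Suc k)))) \<in> Ualg q"
      proof (intro sub)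
        fix k assume "k \<in> {..<m}"
        then show "aw Y (2*Suc k) \<in> Ualg q" "aw X (2*(n-Suc k)) \<in> Ualg q"
          using less[of "Suc k"] less[of "n - Suc k"] Suc by auto
      qed
      from sub(2)[OF a this] show ?thesis
        unfolding add_diff_cancel_middle .
    qed
    moreover have "aw Y (2*n) - aw X (2*n) \<in> Ualg q" (is "?d \<in> _")
    proof (rule Ualg_scaleD[OF _ c_ne_0])
      have "aw Y (Suc 0) \<star> aw X (Suc (2*m)) - aw X (Suc (2*m)) \<star> aw Y (Suc 0) \<in> Ualg q"
        using less[of m] Suc y by (intro sub) auto
      then show "vscale (1 - inverse (q\<^sup>2)) (aw Y (2*n) - aw X (2*n)) \<in> Ualg q"
        using letter_odd_comm[of X m] Suc by simp
    qed
    ultimately have "?s + ?d \<in> Ualg q" by (rule sub)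
    also have "?s + ?d = vscale (1 + p ^ n) (aw Y (2*n))"
      unfolding add_add_diff_cancel fs.scale_left_distrib fs.scale_one ..
    finally have Y: "aw Y (2*n) \<in> Ualg q"
      by (rule Ualg_scaleD) (use pow_inverse_ne[of n] Suc in \<open>simp add: p_def\<close>)
    from sub(2)[OF this \<open>?d \<in> _\<close>] have X: "aw X (2*n) \<in> Ualg q"
      by (simp only: diff_diff_eq2 add_diff_cancel_left')
    have "aw b (Suc (2*n)) \<in> Ualg q" if "aw b (2*n) \<in> Ualg q" "aw b (Suc 0) \<in> Ualg q" for b
    proof (rule Ualg_scaleD[OF _ c_ne_0])
      have "aw b (2*n) \<star> aw b (Suc 0) - vscale (inverse (q\<^sup>2)) (aw b (Suc 0) \<star> aw b (2*n)) \<in> Ualg q"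
        using that by (intro sub) auto
      then show "vscale (1 - inverse (q\<^sup>2)) (aw b (Suc (2*n))) \<in> Ualg q"
        using letter_even_comm[of "other b" n] by simp
    qed
    then show ?thesis using X Y x y by blast
  qed
qed

text \<open>Two relations together lower the even word by two letters: \<open>odd_even_comm\<close>
  replaces the index pair \<open>(k, Suc l)\<close> by \<open>(l, Suc k)\<close>, and the twisted
  relation replaces that by \<open>(Suc k, l)\<close>, always modulo products already in the desired
  order. The odd word grows meanwhile, hence the generality in \<open>k\<close>.\<close>

lemma odd_even_exchange_other:
  "aw a (Suc (2*k)) \<star> aw (other a) (2*l) \<in> smul q (evenw (other a)) (oddw a)"
proof (induction l arbitrary: k)
  case 0
  have "aw (other a) (2*0) \<star> aw a (Suc (2*k)) \<in> smul q (evenw (other a)) (oddw a)"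
    unfolding evenw_def oddw_def by blast
  then show ?case by simp
next
  case (Suc l)
  let ?V = "smul q (evenw (other a)) (oddw a)"
  have b: "aw (other a) (2*i) \<star> aw a (Suc (2*j)) \<in> ?V" for i j
    unfolding evenw_def oddw_def by blast
  note sub = fs.subspace_add[OF smul_subspace] fs.subspace_diff[OF smul_subspace]
    fs.subspace_scale[OF smul_subspace]
  let ?x = "aw a (Suc (2*l)) \<star> aw (other a) (2*Suc k)"
  have "vscale (q\<^sup>2) ?x = aw (other a) (2*Suc k) \<star> aw a (Suc (2*l))
      - (aw (other a) (2*l) \<star> aw a (Suc (2*Suc k)) - vscale (q\<^sup>2) (aw a (Suc (2*Suc k)) \<star> aw (other a) (2*l)))"
    by (rule eq_diff_of_diff_eq) (rule odd_even_twisted[where k = "Suc k" and a = a and l = l])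
  also have "\<dots> \<in> ?V" by (intro sub b Suc)
  finally have "vscale (inverse (q\<^sup>2)) (vscale (q\<^sup>2) ?x) \<in> ?V" by (rule sub)
  then have x: "?x \<in> ?V" using q0 by simp
  have "aw a (Suc (2*k)) \<star> aw (other a) (2*Suc l)
    = ?x - aw (other a) (2*Suc k) \<star> aw a (Suc (2*l)) + aw (other a) (2*Suc l) \<star> aw a (Suc (2*k))"
    by (rule eq_add_of_diff_eq) (rule odd_even_comm[where a = a and k = k and l = l])
  also have "\<dots> \<in> ?V" by (intro sub b x)
  finally show ?case .
qed

lemma even_odd_exchange_other:
  "aw (other a) (2*l) \<star> aw a (Suc (2*k)) \<in> smul q (oddw a) (evenw (other a))"
proof (induction l arbitrary: k)
  case 0
  have "aw a (Suc (2*k)) \<star> aw (other a) (2*0) \<in> smul q (oddw a) (evenw (other a))"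
    unfolding evenw_def oddw_def by blast
  then show ?case by simp
next
  case (Suc l)
  let ?V = "smul q (oddw a) (evenw (other a))"
  have b: "aw a (Suc (2*j)) \<star> aw (other a) (2*i) \<in> ?V" for i j
    unfolding evenw_def oddw_def by blast
  note sub = fs.subspace_add[OF smul_subspace] fs.subspace_diff[OF smul_subspace]
    fs.subspace_scale[OF smul_subspace]
  let ?x = "aw (other a) (2*Suc k) \<star> aw a (Suc (2*l))"
  have "?x = aw (other a) (2*l) \<star> aw a (Suc (2*Suc k)) - vscale (q\<^sup>2) (aw a (Suc (2*Suc k)) \<star> aw (other a) (2*l))
      + vscale (q\<^sup>2) (aw a (Suc (2*l)) \<star> aw (other a) (2*Suc k))"
    by (rule eq_add_of_diff_eq) (rule odd_even_twisted[where k = "Suc k" and a = a and l = l])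
  also have "\<dots> \<in> ?V" by (intro sub b Suc)
  finally have x: "?x \<in> ?V" .
  have "aw (other a) (2*Suc l) \<star> aw a (Suc (2*k))
    = aw a (Suc (2*k)) \<star> aw (other a) (2*Suc l) - (aw a (Suc (2*l)) \<star> aw (other a) (2*Suc k) - ?x)"
    by (rule eq_diff_of_diff_eq) (rule odd_even_comm[where a = a and k = k and l = l])
  also have "\<dots> \<in> ?V" by (intro sub b x)
  finally show ?case .
qed

lemma revf_smul:
  assumes "f \<in> smul q A B"
  shows "revf f \<in> smul q (revf ` B) (revf ` A)"
  using assms unfolding smul_def[of q A B]
proof (induction rule: fs.span_induct_alt)
  case base
  have "revf 0 = (0 :: word \<Rightarrow> 'a)" by (simp add: revf_def fun_eq_iff pointwise)
  then show ?case using fs.subspace_0[OF smul_subspace] by simp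
next
  case (step c x y)
  then show ?case
    by (auto simp: revf_star[OF q0] intro!: smul_memI imageI fs.subspace_add[OF smul_subspace] fs.subspace_scale[OF smul_subspace])
qed

lemma revf_oddw: "revf ` oddw a = oddw a"
  by (simp add: oddw_def image_image revf_aw)

lemma revf_evenw: "revf ` evenw (other a) = evenw a"
  by (simp add: evenw_def image_image revf_aw)

text \<open>If both words start with the same letter, reversal reduces to the case of different
  letters: odd alternating words are palindromes, and reversing a nonempty even one changes its
  first letter.\<close>

lemma exchange_odd_even:
  assumes "f \<in> oddw a" "g \<in> evenw c"
  shows "f \<star> g \<in> smul q (evenw c) (oddw a)" "g \<star> f \<in> smul q (oddw a) (evenw c)"
proof -
  obtain k l where fg: "f = aw a (Suc (2*k))" "g = aw c (2*l)"
    using assms by (auto simp: oddw_def evenw_def)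
  have "f \<star> g \<in> smul q (evenw c) (oddw a) \<and> g \<star> f \<in> smul q (oddw a) (evenw c)"
  proof (cases "c = a")
    case True
    show ?thesis
      using revf_smul[OF even_odd_exchange_other[of a l k]] revf_smul[OF odd_even_exchange_other[of a k l]]
      by (simp add: fg True revf_star[OF q0] revf_oddw revf_evenw revf_aw)
  next
    case False
    then have "c = other a" by (cases a; cases c) auto
    then show ?thesis
      using odd_even_exchange_other[of a k l] even_odd_exchange_other[of a l k] fg by simp
  qed
  then show "f \<star> g \<in> smul q (evenw c) (oddw a)" "g \<star> f \<in> smul q (oddw a) (evenw c)"
    by blast+
qed

text \<open>An exchange may yield many products with new indices, but each still has exactly one
  factor from \<open>A\<close>. So an induction over the factors from \<open>B\<close> terminates,
  with the factor from \<open>A\<close> kept arbitrary.\<close>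

lemma exchange_gen_alg:
  assumes ex: "\<And>a b. a \<in> A \<Longrightarrow> b \<in> B \<Longrightarrow> a \<star> b \<in> smul q B A"
    and "a \<in> A" "f \<in> alg q B"
  shows "a \<star> f \<in> smul q (alg q B) A"
proof (rule alg_right[OF assms(3)])
  fix l assume "l \<in> lists B"
  then show "a \<star> sprod q l \<in> smul q (alg q B) A"
    using \<open>a \<in> A\<close>
  proof (induction l arbitrary: a)
    case Nil
    then show ?case using smul_memI[of vone "alg q B" a A q] by simp
  next
    case (Cons b l)
    have "(a \<star> b) \<star> sprod q l \<in> smul q (alg q B) A"
    proof (rule smul_left[OF ex[OF Cons.prems \<open>b \<in> B\<close>]])
      fix b' a' assume ba: "b' \<in> B" "a' \<in> A"
      have "b' \<star> (a' \<star> sprod q l) \<in> smul q (alg q B) A"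
      proof (rule smul_right[OF Cons.IH[OF ba(2)]])
        fix g c assume "g \<in> alg q B" "c \<in> A"
        then have "(b' \<star> g) \<star> c \<in> smul q (alg q B) A"
          by (intro smul_memI alg_gen_left ba)
        then show "b' \<star> (g \<star> c) \<in> smul q (alg q B) A" by (simp add: assoc)
      qed simp
      then show "b' \<star> a' \<star> sprod q l \<in> smul q (alg q B) A" by (simp add: assoc)
    qed simp
    then show ?case by (simp add: assoc)
  qed
qed simp

lemma exchange_alg:
  assumes ex: "\<And>a b. a \<in> A \<Longrightarrow> b \<in> B \<Longrightarrow> a \<star> b \<in> smul q B A"
    and "g \<in> alg q A" "f \<in> alg q B"
  shows "g \<star> f \<in> smul q (alg q B) (alg q A)"
proof (rule alg_left[OF assms(2)])
  fix l assume "l \<in> lists A"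
  then show "sprod q l \<star> f \<in> smul q (alg q B) (alg q A)"
  proof (induction l)
    case Nil
    then show ?case using smul_memI[of f "alg q B" vone "alg q A" q] assms(3) by simp
  next
    case (Cons a l)
    have "a \<star> (sprod q l \<star> f) \<in> smul q (alg q B) (alg q A)"
    proof (rule smul_right[OF Cons.IH])
      fix b g assume bg: "b \<in> alg q B" "g \<in> alg q A"
      have "(a \<star> b) \<star> g \<in> smul q (alg q B) (alg q A)"
      proof (rule smul_left[OF exchange_gen_alg[OF ex \<open>a \<in> A\<close> bg(1)]])
        fix b' a' assume "b' \<in> alg q B" "a' \<in> A"
        then have "b' \<star> (a' \<star> g) \<in> smul q (alg q B) (alg q A)"
          by (intro smul_memI alg_gen_left bg)
        then show "b' \<star> a' \<star> g \<in> smul q (alg q B) (alg q A)" by (simp add: assoc)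
      qed simp_all
      then show "a \<star> (b \<star> g) \<in> smul q (alg q B) (alg q A)" by (simp add: assoc)
    qed simp
    then show ?case by (simp add: assoc)
  qed
qed simp

section \<open>Stability of the ordered span under the letters\<close>

abbreviation Q where "Q \<equiv> smul q (alg q (evenw X)) (alg q (oddw Y))"
abbreviation M where "M \<equiv> smul q (alg q (oddw X)) Q"

lemma Q_evenX:
  assumes "g \<in> evenw X" "h \<in> Q"
  shows "g \<star> h \<in> Q"
proof (rule smul_right[OF assms(2)])
  fix a b assume "a \<in> alg q (evenw X)" "b \<in> alg q (oddw Y)"
  then have "(g \<star> a) \<star> b \<in> Q" by (intro smul_memI alg_gen_left assms)
  then show "g \<star> (a \<star> b) \<in> Q" by (simp add: assoc)
qed simp

lemma Q_oddY:
  assumes "w \<in> oddw Y" "h \<in> Q"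
  shows "w \<star> h \<in> Q"
proof (rule smul_right[OF assms(2)])
  fix a b assume ab: "a \<in> alg q (evenw X)" "b \<in> alg q (oddw Y)"
  have "(w \<star> a) \<star> b \<in> Q"
  proof (rule smul_left[OF exchange_gen_alg[OF exchange_odd_even(1) assms(1) ab(1)]])
    fix a' w' :: "word \<Rightarrow> 'a" assume "a' \<in> alg q (evenw X)" "w' \<in> oddw Y"
    then have "a' \<star> (w' \<star> b) \<in> Q" by (intro smul_memI alg_gen_left ab)
    then show "a' \<star> w' \<star> b \<in> Q" by (simp add: assoc)
  qed simp_all
  then show "w \<star> (a \<star> b) \<in> Q" by (simp add: assoc)
qed simp

lemma M_algX:
  assumes "p \<in> alg q (oddw X)" "h \<in> M"
  shows "p \<star> h \<in> M"
proof (rule smul_right[OF assms(2)])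
  fix a b assume "a \<in> alg q (oddw X)" "b \<in> Q"
  then have "(p \<star> a) \<star> b \<in> M" by (intro smul_memI alg_mult assms)
  then show "p \<star> (a \<star> b) \<in> M" by (simp add: assoc)
qed simp

lemma Q_subset_M: "h \<in> Q \<Longrightarrow> h \<in> M"
  using smul_memI[of vone "alg q (oddw X)" h Q q] by simp

text \<open>\<open>even_sum\<close> is solved for its last term. In the other terms a shorter even
  word starting with \<open>Y\<close> stands before a word from \<open>evenw X\<close>, which
  \<open>Q\<close> absorbs; the induction therefore needs \<open>h\<close> arbitrary in
  \<open>Q\<close>.\<close>

lemma M_evenY_Q: "h \<in> Q \<Longrightarrow> aw Y (2*n) \<star> h \<in> M"
proof (induction n arbitrary: h rule: less_induct)
  case (less n)
  show ?case
  proof (cases "n = 0")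
    case False
    define p where "p = inverse (q\<^sup>2)"
    have p: "p \<noteq> 0" using q0 by (simp add: p_def)
    have 1: "(aw Y (2*k) \<star> aw X (2*(n-k))) \<star> h \<in> M" if "k < n" for k
      using less.IH[OF that Q_evenX[OF _ less.prems]] by (simp add: assoc evenw_def)
    have 2: "(aw X (Suc (2*k)) \<star> aw Y (Suc (2*j))) \<star> h \<in> M" for k j
    proof -
      have "aw X (Suc (2*k)) \<star> (aw Y (Suc (2*j)) \<star> h) \<in> M"
        by (intro M_algX gen_alg Q_subset_M Q_oddY less.prems) (auto simp: oddw_def)
      then show ?thesis by (simp add: assoc)
    qed
    have "(\<Sum>k<n. vscale (p ^ k) (aw Y (2*k) \<star> aw X (2*(n-k)))) + vscale (p ^ n) (aw Y (2*n))
       = (\<Sum>k\<le>n. vscale (p ^ k) (aw Y (2*k) \<star> aw X (2*(n-k))))"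
      by (simp flip: lessThan_Suc_atMost)
    also have "\<dots> = (\<Sum>k<n. vscale (p ^ k) (aw X (Suc (2*k)) \<star> aw Y (Suc (2*(n-k-1)))))"
      using even_sum[of n] False by (simp add: p_def)
    finally have "vscale (p ^ n) (aw Y (2*n)) = (\<Sum>k<n. vscale (p ^ k) (aw X (Suc (2*k)) \<star> aw Y (Suc (2*(n-k-1)))))
       - (\<Sum>k<n. vscale (p ^ k) (aw Y (2*k) \<star> aw X (2*(n-k))))"
      by (rule eq_diff_of_add_eq)
    then have "vscale (p ^ n) (aw Y (2*n)) \<star> h = (\<Sum>k<n. vscale (p ^ k) (aw X (Suc (2*k)) \<star> aw Y (Suc (2*(n-k-1))) \<star> h))
       - (\<Sum>k<n. vscale (p ^ k) (aw Y (2*k) \<star> aw X (2*(n-k)) \<star> h))"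
      by (simp add: star_sum_left)
    also have "\<dots> \<in> M"
      by (intro fs.subspace_diff[OF smul_subspace] fs.subspace_sum[OF smul_subspace]
          fs.subspace_scale[OF smul_subspace] 1 2) auto
    finally have "vscale (p ^ n) (aw Y (2*n) \<star> h) \<in> M" by simp
    from fs.subspace_scale[OF smul_subspace this, of "inverse (p ^ n)"] show ?thesis
      using p by simp
  qed (use less.prems Q_subset_M in simp)
qed

text \<open>Exchange with the odd words starting with \<open>X\<close> keeps the first letter of the
  even factor, so what reaches \<open>Q\<close> is again an even word of the same kind. Only there
  do the cases \<open>X\<close> and \<open>Y\<close> differ.\<close>

lemma M_even:
  assumes "h \<in> M" "g \<in> evenw c"
  shows "g \<star> h \<in> M"
proof (rule smul_right[OF assms(1)])
  fix p r assume pr: "p \<in> alg q (oddw X)" "r \<in> Q"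
  have "(g \<star> p) \<star> r \<in> M"
  proof (rule smul_left[OF exchange_gen_alg[OF exchange_odd_even(2) assms(2) pr(1)]])
    fix p' g' :: "word \<Rightarrow> 'a" assume g': "p' \<in> alg q (oddw X)" "g' \<in> evenw c"
    have "g' \<star> r \<in> M"
      using g'(2) Q_evenX[OF _ pr(2), of g'] M_evenY_Q[OF pr(2)] Q_subset_M
      by (cases c) (auto simp: evenw_def)
    then have "p' \<star> (g' \<star> r) \<in> M" using g'(1) M_algX by blast
    then show "p' \<star> g' \<star> r \<in> M" by (simp add: assoc)
  qed simp_all
  then show "g \<star> (p \<star> r) \<in> M" by (simp add: assoc)
qed simp

lemma M_letter:
  assumes "h \<in> M"
  shows "aw a (Suc 0) \<star> h \<in> M"
proof (cases a)
  case X
  have "aw X (Suc 0) \<in> oddw X" unfolding oddw_def by (rule range_eqI[of _ _ 0]) simp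
  then show ?thesis using M_algX assms gen_alg X by blast
next
  case Y
  have y: "aw Y (Suc 0) \<in> oddw Y" unfolding oddw_def by (rule range_eqI[of _ _ 0]) simp
  have "aw Y (Suc 0) \<star> h \<in> M"
  proof (rule smul_right[OF assms])
    fix p r assume pr: "p \<in> alg q (oddw X)" "r \<in> Q"
    have "aw Y (Suc 0) \<star> (sprod q l \<star> r) \<in> M" if "l \<in> lists (oddw X)" for l
      using that
    proof (induction l)
      case Nil
      then show ?case using Q_subset_M[OF Q_oddY[OF y pr(2)]] by simp
    next
      case (Cons f l)
      \<comment> \<open>Everything to the right of \<open>f\<close> is itself in \<open>M\<close>,
        so \<open>M_even\<close> absorbs the even words that appear when \<open>Y\<close> is moved
        past \<open>f\<close>.\<close>
      define r' where "r' = sprod q l \<star> r"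
      have r': "r' \<in> M" unfolding r'_def using pr Cons.hyps by (intro smul_memI sprod_alg) auto
      obtain k where f: "f = aw X (Suc (2*k))" using Cons.hyps by (auto simp: oddw_def)
      have yf: "aw Y (Suc 0) \<star> f = f \<star> aw Y (Suc 0)
          + vscale (1 - inverse (q\<^sup>2)) (aw Y (2*Suc k) - aw X (2*Suc k))"
        using letter_odd_comm[of X k] unfolding f by (simp add: diff_eq_eq add.commute)
      have "aw Y (Suc 0) \<star> (f \<star> r') = (aw Y (Suc 0) \<star> f) \<star> r'"
        by (simp only: assoc)
      also have "\<dots> = f \<star> (aw Y (Suc 0) \<star> r')
          + vscale (1 - inverse (q\<^sup>2)) (aw Y (2*Suc k) \<star> r' - aw X (2*Suc k) \<star> r')"
        unfolding yf by (simp add: assoc)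
      also have "\<dots> \<in> M"
      proof -
        have "f \<star> (aw Y (Suc 0) \<star> r') \<in> M"
          using Cons by (simp add: r'_def M_algX[OF gen_alg])
        moreover have "aw b (2*Suc k) \<star> r' \<in> M" for b
          by (rule M_even[OF r', of _ b]) (unfold evenw_def, rule rangeI)
        ultimately show ?thesis
          by (intro fs.subspace_add[OF smul_subspace] fs.subspace_diff[OF smul_subspace]
          fs.subspace_scale[OF smul_subspace])
      qed
      finally show ?case by (simp only: r'_def assoc sprod_simps)
    qed
    then have "aw Y (Suc 0) \<star> (p \<star> r) \<in> M"
      by (intro star_span_right[OF _ smul_subspace, of "p \<star> r" "{sprod q l \<star> r |l. l \<in> lists (oddw X)}"]
        star_span_left[OF pr(1)[unfolded alg_def]]) (auto intro: fs.span_base)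
    then show "aw Y (Suc 0) \<star> (p \<star> r) \<in> M" .
  qed simp
  then show ?thesis using Y by simp
qed

lemma letters_M: "sprod q (map (\<lambda>a. aw a (Suc 0)) w) \<in> M"
proof (induction w)
  case Nil
  have "vone \<star> (vone \<star> vone) \<in> M" by (intro smul_memI) simp_all
  then show ?case by simp
next
  case (Cons a w)
  then show ?case using M_letter by simp
qed

text \<open>Even words can be exchanged with odd ones of either kind. Moving the even block to the
  right end or, in the next lemma, to the left end gives two further orders.\<close>

lemma letters_M2: "sprod q (map (\<lambda>a. aw a (Suc 0)) w) \<in> smul q (alg q (oddw X)) (smul q (alg q (oddw Y)) (alg q (evenw X)))"
proof -
  have "M \<subseteq> smul q (alg q (oddw X)) (smul q (alg q (oddw Y)) (alg q (evenw X)))"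
  proof (rule smul_subset)
    fix a b assume "a \<in> alg q (oddw X)" "b \<in> Q"
    moreover have "Q \<subseteq> smul q (alg q (oddw Y)) (alg q (evenw X))"
      by (rule smul_subset) (auto intro: exchange_alg exchange_odd_even)
    ultimately show "a \<star> b \<in> smul q (alg q (oddw X)) (smul q (alg q (oddw Y)) (alg q (evenw X)))"
      by blast
  qed simp
  then show ?thesis using letters_M by blast
qed

lemma letters_M3: "sprod q (map (\<lambda>a. aw a (Suc 0)) w) \<in> smul q (alg q (evenw X)) (smul q (alg q (oddw X)) (alg q (oddw Y)))"
    (is "_ \<in> ?V")
proof -
  have "M \<subseteq> ?V"
  proof (rule smul_subset)
    fix a b assume a: "a \<in> alg q (oddw X)" and "b \<in> Q"
    from this(2) show "a \<star> b \<in> ?V"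
    proof (rule smul_right)
      fix g w :: "word \<Rightarrow> 'a" assume gw: "g \<in> alg q (evenw X)" "w \<in> alg q (oddw Y)"
      have "(a \<star> g) \<star> w \<in> ?V"
      proof (rule smul_left[OF exchange_alg[OF exchange_odd_even(1) a gw(1)]])
        fix g' a' :: "word \<Rightarrow> 'a" assume "g' \<in> alg q (evenw X)" "a' \<in> alg q (oddw X)"
        then show "g' \<star> a' \<star> w \<in> ?V"
          unfolding assoc by (intro smul_memI gw)
      qed simp_all
      then show "a \<star> (g \<star> w) \<in> ?V" by (simp add: assoc)
    qed simp
  qed simp
  then show ?thesis using letters_M by blast
qed

end

section \<open>Linear independence\<close>

lemma ld_Nil [simp]: "ld [] f = f"
  by (simp add: ld_def)

lemma ld_Cons: "ld (a # u) f = ld u (dl a f)"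
  by (simp add: ld_def dl_def)

lemma ld_simps [simp]:
  "ld u (f + g) = ld u f + ld u g" "ld u (vscale c f) = vscale c (ld u f)" "ld u 0 = 0"
  by (auto simp: ld_def fun_eq_iff pointwise)

lemma ld_sum: "ld u (sum f A) = (\<Sum>i\<in>A. ld u (f i))" for f :: "'i \<Rightarrow> word \<Rightarrow> 'a::field"
  using sum_comp_morphism[of "ld u" f A] by (simp add: o_def)

lemma tw_sum: "tw q z (sum f A) = (\<Sum>i\<in>A. tw q z (f i))" for f :: "'i \<Rightarrow> word \<Rightarrow> 'a::field"
  using sum_comp_morphism[of "tw q z" f A] by (simp add: o_def)

lemma dl_pow_simps [simp]:
  "(dl a ^^ n) (f + g) = (dl a ^^ n) f + (dl a ^^ n) g"
  "(dl a ^^ n) (vscale c f) = vscale c ((dl a ^^ n) f)" "(dl a ^^ n) 0 = 0"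
  by (induction n; simp)+

lemma dl_pow_sum: "(dl a ^^ n) (sum f A) = (\<Sum>i\<in>A. (dl a ^^ n) (f i))" for f :: "'i \<Rightarrow> word \<Rightarrow> 'a::field"
  using sum_comp_morphism[of "dl a ^^ n" f A] by (simp add: o_def)

lemma dl_pow_vone: "n > 0 \<Longrightarrow> (dl a ^^ n) vone = 0"
  by (cases n) (simp_all add: funpow_swap1)

lemma ld_homog_full:
  assumes "homog l d f" "int (length u) = l"
  shows "ld u f = vscale (f u) vone"
proof
  fix w
  show "ld u f w = vscale (f u) vone w"
    using assms by (cases w) (auto simp: ld_def homog_def pointwise)
qed

lemma ld_homog_zero:
  assumes "homog l d f" "int (length u) > l"
  shows "ld u f = 0"
  using assms by (auto simp: ld_def homog_def pointwise fun_eq_iff)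

lemma homog_vprepend: "homog l d f \<Longrightarrow> homog (l + 1) (d + dg a) (vprepend a f)"
  by (auto simp: homog_def vprepend_def split: list.splits if_splits)

text \<open>The coefficients of \<open>E(t)\<close>. The recursion encodes the left deletions
  \<open>dl Y E(t) = 1\<close> and \<open>dl X E(t) = - q\<^sup>-\<^sup>2 t E(t) E(t)\<close>, which are forced by \<open>E(t) G(t) = W(t)\<close>
  for the generating functions of the \<open>aw X (2 * k)\<close> and the \<open>aw Y (2 * k + 1)\<close>.\<close>

fun Ev :: "'a::field \<Rightarrow> nat \<Rightarrow> word \<Rightarrow> 'a" where
  "Ev q 0 = aw Y (Suc 0)"
| "Ev q (Suc n) = vscale (- inverse (q\<^sup>2)) (vprepend X (\<Sum>i\<le>n. star q (Ev q i) (Ev q (n - i))))"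

definition elen :: "nat list \<Rightarrow> nat" where
  "elen \<nu> = (\<Sum>n\<leftarrow>\<nu>. 2 * n + 1)"

lemma elen_simps [simp]: "elen [] = 0" "elen (n # \<nu>) = 2 * n + 1 + elen \<nu>"
  by (simp_all add: elen_def)

definition eprod :: "'a::field \<Rightarrow> nat list \<Rightarrow> word \<Rightarrow> 'a" where
  "eprod q \<nu> = sprod q (map (Ev q) \<nu>)"

lemma eprod_simps [simp]: "eprod q [] = vone" "eprod q (n # \<nu>) = star q (Ev q n) (eprod q \<nu>)"
  by (simp_all add: eprod_def)

text \<open>Zero entries are allowed and contribute the unit; they serve as padding in the
  independence proof.\<close>

definition aprod :: "'a::field \<Rightarrow> letter \<Rightarrow> nat list \<Rightarrow> word \<Rightarrow> 'a" where
  "aprod q a T = sprod q (map (aw a) T)"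

lemma aprod_simps [simp]: "aprod q a [] = vone" "aprod q a (n # T) = star q (aw a n) (aprod q a T)"
  by (simp_all add: aprod_def)

lemma dl_Ev [simp]:
  "dl Y (Ev q 0) = vone" "dl X (Ev q 0) = 0" "dl Y (Ev q (Suc n)) = 0"
  "dl X (Ev q (Suc n)) = vscale (- inverse (q\<^sup>2)) (\<Sum>i\<le>n. star q (Ev q i) (Ev q (n - i)))"
  by simp_all

lemma homog_Ev: "homog (int (2 * n + 1)) 1 (Ev q n)"
proof (induction n rule: less_induct)
  case (less n)
  show ?case
  proof (cases n)
    case 0
    then show ?thesis using homog_aw[of "Suc 0" Y] by simp
  next
    case (Suc m)
    have "homog (int (2 * m + 2)) 2 (star q (Ev q i) (Ev q (m - i)))" if "i \<le> m" for i
      using homog_star[OF less[of i] less[of "m - i"], of q] that Suc by (simp add: algebra_simps of_nat_diff)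
    then have "homog (int (2 * m + 2)) 2 (\<Sum>i\<le>m. star q (Ev q i) (Ev q (m - i)))"
      by (intro homog_sum) simp
    from homog_scale[OF homog_vprepend[OF this, of X]] show ?thesis
      unfolding Suc Ev.simps by (simp add: add.commute del: fs.scale_minus_left)
  qed
qed

lemma tw_Ev: "tw q z (Ev q n) = vscale (q powi (2 * z)) (Ev q n)"
  using homog_tw_eq[OF homog_Ev[of n q]] by simp

lemma homog_eprod: "homog (int (elen \<nu>)) (int (length \<nu>)) (eprod q \<nu>)"
proof (induction \<nu>)
  case (Cons n \<nu>)
  from homog_star[OF homog_Ev Cons] show ?case by (simp add: algebra_simps)
qed (simp add: homog_vone)

declare Ev.simps [simp del]

section \<open>Prefix deletion from products, and the elements \<open>Ev\<close>\<close>

context qshuf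
begin

lemma ld_tw: "ld s (tw q z f) = vscale (q powi (2 * defect s * z)) (tw q z (ld s f))"
  using q0 by (auto simp: ld_def tw_def fun_eq_iff pointwise algebra_simps power_int_add)

text \<open>A prefix of a shuffle of two words splits into a prefix of each of them. The lengths and
  defects of these two prefixes add up, and that is all the vanishing arguments below use.\<close>

lemma ld_star_zero:
  assumes "\<And>s t. length s + length t = length u \<Longrightarrow> defect s + defect t = defect u
      \<Longrightarrow> ld s f = 0 \<or> ld t g = 0"
  shows "ld u (f \<star> g) = 0"
  using assms
proof (induction u arbitrary: f g)
  case Nil
  from Nil[of "[]" "[]"] show ?case by auto
next
  case (Cons a u)
  have 1: "ld u (dl a f \<star> g) = 0"
  proof (rule Cons.IH)
    fix s t assume "length s + length t = length u" "defect s + defect t = defect u"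
    then show "ld s (dl a f) = 0 \<or> ld t g = 0"
      using Cons.prems[of "a # s" t] by (simp add: ld_Cons)
  qed
  have 2: "ld u (tw q (dg a) f \<star> dl a g) = 0"
  proof (rule Cons.IH)
    fix s t assume "length s + length t = length u" "defect s + defect t = defect u"
    then show "ld s (tw q (dg a) f) = 0 \<or> ld t (dl a g) = 0"
      using Cons.prems[of s "a # t"] by (auto simp: ld_Cons ld_tw)
  qed
  show ?case using 1 2 by (simp add: ld_Cons)
qed

lemma ld_star_left:
  assumes "\<And>s t. length s + length t = length u \<Longrightarrow> defect s + defect t = defect u \<Longrightarrow> t \<noteq> []
      \<Longrightarrow> ld s f = 0 \<or> ld t g = 0"
  shows "ld u (f \<star> g) = ld u f \<star> g"
  using assms
proof (induction u arbitrary: f g)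
  case (Cons a u)
  have 1: "ld u (dl a f \<star> g) = ld u (dl a f) \<star> g"
  proof (rule Cons.IH)
    fix s t assume "length s + length t = length u" "defect s + defect t = defect u" "t \<noteq> []"
    then show "ld s (dl a f) = 0 \<or> ld t g = 0"
      using Cons.prems[of "a # s" t] by (simp add: ld_Cons)
  qed
  have 2: "ld u (tw q (dg a) f \<star> dl a g) = 0"
  proof (rule ld_star_zero)
    fix s t assume "length s + length t = length u" "defect s + defect t = defect u"
    then show "ld s (tw q (dg a) f) = 0 \<or> ld t (dl a g) = 0"
      using Cons.prems[of s "a # t"] by (auto simp: ld_Cons ld_tw)
  qed
  show ?case using 1 2 by (simp add: ld_Cons)
qed simp

text \<open>No letter of the prefix can come from \<open>f\<close>, so all of them pass
  \<open>f\<close> on the way out, and their twists add up to \<open>defect u\<close>.\<close>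

lemma ld_star_right:
  assumes "\<And>s t. length s + length t = length u \<Longrightarrow> defect s + defect t = defect u \<Longrightarrow> s \<noteq> []
      \<Longrightarrow> ld s f = 0 \<or> ld t g = 0"
  shows "ld u (f \<star> g) = tw q (defect u) f \<star> ld u g"
  using assms
proof (induction u arbitrary: f g)
  case (Cons a u)
  have 1: "ld u (dl a f \<star> g) = 0"
  proof (rule ld_star_zero)
    fix s t assume "length s + length t = length u" "defect s + defect t = defect u"
    then show "ld s (dl a f) = 0 \<or> ld t g = 0"
      using Cons.prems[of "a # s" t] by (simp add: ld_Cons)
  qed
  have 2: "ld u (tw q (dg a) f \<star> dl a g) = tw q (defect u) (tw q (dg a) f) \<star> ld u (dl a g)"
  proof (rule Cons.IH)
    fix s t assume "length s + length t = length u" "defect s + defect t = defect u" "s \<noteq> []"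
    then show "ld s (tw q (dg a) f) = 0 \<or> ld t (dl a g) = 0"
      using Cons.prems[of s "a # t"] by (auto simp: ld_Cons ld_tw)
  qed
  show ?case using 1 2 by (simp add: ld_Cons tw_tw[OF q0] add.commute)
qed simp

lemma ld_star_both:
  assumes "\<And>s t. length s + length t = length u \<Longrightarrow> defect s + defect t = defect u \<Longrightarrow> s \<noteq> []
      \<Longrightarrow> t \<noteq> [] \<Longrightarrow> ld s f = 0 \<or> ld t g = 0"
    and "u \<noteq> []"
  shows "ld u (f \<star> g) = ld u f \<star> g + tw q (defect u) f \<star> ld u g"
proof (cases u)
  case (Cons a v)
  have 1: "ld v (dl a f \<star> g) = ld v (dl a f) \<star> g"
  proof (rule ld_star_left)
    fix s t assume "length s + length t = length v" "defect s + defect t = defect v" "t \<noteq> []"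
    then show "ld s (dl a f) = 0 \<or> ld t g = 0"
      using assms(1)[of "a # s" t] Cons by (simp add: ld_Cons)
  qed
  have 2: "ld v (tw q (dg a) f \<star> dl a g) = tw q (defect v) (tw q (dg a) f) \<star> ld v (dl a g)"
  proof (rule ld_star_right)
    fix s t assume "length s + length t = length v" "defect s + defect t = defect v" "s \<noteq> []"
    then show "ld s (tw q (dg a) f) = 0 \<or> ld t (dl a g) = 0"
      using assms(1)[of s "a # t"] Cons by (auto simp: ld_Cons ld_tw)
  qed
  show ?thesis using 1 2 Cons by (simp add: ld_Cons tw_tw[OF q0] add.commute)
qed (use assms in simp)

lemma ld_star_nonzeroE:
  assumes "ld u (f \<star> g) \<noteq> 0"
  obtains s t where "length s + length t = length u" "defect s + defect t = defect u"
    "ld s f \<noteq> 0" "ld t g \<noteq> 0"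
  using assms ld_star_zero by metis

text \<open>For \<open>n > 0\<close> the words of \<open>Ev q n\<close> are \<open>X\<close>
  followed by a shuffle of words from two smaller \<open>Ev\<close>. The \<open>X\<close> costs one
  unit of defect, and each shuffled part regains at most one, only when exhausted. So defect 1 is
  reached only when both parts are exhausted, that is, at the end of the word.\<close>

lemma ld_Ev:
  assumes "ld s (Ev q n) \<noteq> 0"
  shows "defect s \<le> 0 \<or> defect s = 1 \<and> length s = 2 * n + 1"
  using assms
proof (induction n arbitrary: s rule: less_induct)
  case (less n)
  show ?case
  proof (cases s)
    case (Cons a s')
    show ?thesis
    proof (cases n)
      case 0
      then have ld: "ld s' (dl a (Ev q 0)) \<noteq> 0" using less.prems Cons by (simp add: ld_Cons)
      then have a: "a = Y" by (cases a) auto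
      moreover have "ld s' (vone :: word \<Rightarrow> 'a) \<noteq> 0" using ld a by simp
      then have "s' = []"
        using ld_homog_zero[OF homog_vone, of s'] by (cases s') auto
      ultimately show ?thesis using Cons 0 by simp
    next
      case (Suc m)
      have a: "a = X" using less.prems Cons Suc by (cases a) (auto simp: ld_Cons)
      have "(\<Sum>i\<le>m. ld s' (Ev q i \<star> Ev q (m - i))) \<noteq> 0"
        using less.prems Cons Suc a by (auto simp: ld_Cons ld_sum simp del: fs.scale_minus_left)
      then obtain i where i: "i \<le> m" "ld s' (Ev q i \<star> Ev q (m - i)) \<noteq> 0"
        by (meson atMost_iff sum.not_neutral_contains_not_neutral)
      from i(2) obtain u t where ut: "length u + length t = length s'" "defect u + defect t = defect s'"
        "ld u (Ev q i) \<noteq> 0" "ld t (Ev q (m - i)) \<noteq> 0"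
        by (rule ld_star_nonzeroE)
      have "defect u \<le> 0 \<or> defect u = 1 \<and> length u = 2 * i + 1"
        "defect t \<le> 0 \<or> defect t = 1 \<and> length t = 2 * (m - i) + 1"
        using less.IH[OF _ ut(3)] less.IH[OF _ ut(4)] i Suc by auto
      then show ?thesis using ut(1,2) i(1) Suc Cons a by auto
    qed
  qed simp
qed

lemma q2_ne_m1: "1 + q\<^sup>2 \<noteq> 0"
proof
  assume "1 + q\<^sup>2 = 0"
  then have "q\<^sup>2 = - 1" by (simp add: add_eq_0_iff)
  then have "(q\<^sup>2)\<^sup>2 = 1" by simp
  then have "q ^ 4 = 1" by simp
  then show False using q_pow[of 4] by simp
qed

text \<open>The witness begins with \<open>X\<close>, \<open>Y\<close> when \<open>n > 0\<close>,
  and deleting these two letters from \<open>Ev q (Suc n)\<close> returns a multiple of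
  \<open>Ev q n\<close>: \<open>dl Y\<close> kills every \<open>Ev\<close> except
  \<open>Ev q 0\<close>, so only the two ends of the sum contribute, one of them with twist
  \<open>q^2\<close>. Hence the factor \<open>1 + q^2\<close>.\<close>

lemma Ev_nonzero: "Ev q n (alt X (2 * n) @ [Y]) \<noteq> 0"
proof (induction n)
  case 0
  have "Ev q 0 [Y] = dl Y (Ev q 0) []" by (simp add: dl_def)
  then show ?case by simp
next
  case (Suc n)
  let ?w = "alt X (2 * n) @ [Y]"
  have 1: "(\<Sum>i\<le>n. dl Y (Ev q i) \<star> Ev q (n - i)) = Ev q n"
    by (subst sum.atMost_shift) simp
  have "(\<Sum>i\<le>n. tw q (dg Y) (Ev q i) \<star> dl Y (Ev q (n - i)))
    = (\<Sum>i\<in>{n}. tw q (dg Y) (Ev q i) \<star> dl Y (Ev q (n - i)))"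
  proof (rule sum.mono_neutral_right)
    show "\<forall>i\<in>{..n} - {n}. tw q (dg Y) (Ev q i) \<star> dl Y (Ev q (n - i)) = 0"
    proof
      fix i assume "i \<in> {..n} - {n}"
      then have "n - i = Suc (n - i - 1)" by auto
      then show "tw q (dg Y) (Ev q i) \<star> dl Y (Ev q (n - i)) = 0" by (metis dl_Ev(3) star_linear(2))
    qed
  qed auto
  also have "\<dots> = vscale (q\<^sup>2) (Ev q n)" by (simp add: tw_Ev)
  finally have 2: "(\<Sum>i\<le>n. tw q (dg Y) (Ev q i) \<star> dl Y (Ev q (n - i))) = vscale (q\<^sup>2) (Ev q n)" .
  have "Ev q (Suc n) (alt X (2 * Suc n) @ [Y]) = dl Y (dl X (Ev q (Suc n))) ?w"
    by (simp add: dl_def del: dl_Ev)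
  also have "dl Y (dl X (Ev q (Suc n))) = vscale (- inverse (q\<^sup>2)) (Ev q n + vscale (q\<^sup>2) (Ev q n))"
    using 1 2 by (simp add: sum.distrib)
  also have "\<dots> ?w = - inverse (q\<^sup>2) * (1 + q\<^sup>2) * Ev q n ?w"
    by (simp add: pointwise algebra_simps)
  finally show ?case using Suc q0 q2_ne_m1 by simp
qed

text \<open>Deleting \<open>X\<close> from E G~ gives \<open>-p\<close> times E E G~ plus
  \<open>p\<close> times E W+, both with one index less. By induction E G~ may be replaced by W+ in
  the first part, and the two cancel.\<close>

lemma Ev_even_sum: "(\<Sum>i\<le>n. Ev q i \<star> aw X (2 * (n - i))) = aw Y (Suc (2 * n))"
proof (induction n rule: less_induct)
  case (less n)
  let ?H = "\<lambda>n. \<Sum>i\<le>n. Ev q i \<star> aw X (2 * (n - i))"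
  have Y0: "dl Y (aw X k) = 0" for k using dl_aw_other(2)[of X k] by simp
  show ?case
  proof (rule word_fun_eqI2[of _ _ Y])
    have "Ev q i [] = 0" for i
      using homog_Ev[of i q] by (force simp: homog_def)
    then show "?H n [] = aw Y (Suc (2 * n)) []" by (simp add: sum_apply)
  next
    have "dl Y (?H n) = (\<Sum>i\<le>n. dl Y (Ev q i) \<star> aw X (2 * (n - i)))"
      by (simp add: Y0)
    also have "\<dots> = aw X (2 * n)" by (subst sum.atMost_shift) simp
    finally show "dl Y (?H n) = dl Y (aw Y (Suc (2 * n)))" by simp
  next
    define p where "p = inverse (q\<^sup>2)"
    have t: "tw q (dg X) (Ev q i) = vscale p (Ev q i)" for i
      by (simp add: tw_Ev p_def power_int_minus)
    have "dl X (?H n) = (\<Sum>i\<le>n. dl X (Ev q i) \<star> aw X (2 * (n - i)))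
        + (\<Sum>i\<le>n. vscale p (Ev q i \<star> dl X (aw X (2 * (n - i)))))"
      by (simp add: t sum.distrib del: dg.simps)
    also have "(\<Sum>i\<le>n. dl X (Ev q i) \<star> aw X (2 * (n - i)))
      = (\<Sum>i<n. dl X (Ev q (Suc i)) \<star> aw X (2 * (n - Suc i)))"
      by (subst sum.atMost_shift) simp
    also have "\<dots> = (\<Sum>i<n. \<Sum>k\<le>i. vscale (- p) (Ev q k \<star> (Ev q (i - k) \<star> aw X (2 * (n - Suc i)))))"
      by (simp add: star_sum_left assoc p_def fs.scale_sum_right sum_negf)
    \<comment> \<open>With \<open>k\<close> outermost, the sum over \<open>i\<close> becomes the
      convolution for the smaller index \<open>n - k - 1\<close>.\<close>
    also have "\<dots> = (\<Sum>k<n. \<Sum>i\<in>{k..<n}. vscale (- p) (Ev q k \<star> (Ev q (i - k) \<star> aw X (2 * (n - Suc i)))))"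
      unfolding sum.Sigma[OF finite_lessThan ballI[OF finite_atMost]] sum.Sigma[OF finite_lessThan ballI[OF finite_atLeastLessThan]]
      by (rule sum.reindex_bij_witness[of _ "\<lambda>(k, i). (i, k)" "\<lambda>(i, k). (k, i)"]) auto
    also have "\<dots> = (\<Sum>k<n. vscale (- p) (Ev q k \<star> aw Y (Suc (2 * (n - k - 1)))))"
    proof (rule sum.cong)
      fix k assume "k \<in> {..<n}"
      then have k: "k < n" by simp
      have "(\<Sum>i\<in>{k..<n}. vscale (- p) (Ev q k \<star> (Ev q (i - k) \<star> aw X (2 * (n - Suc i)))))
        = (\<Sum>j\<le>n-k-1. vscale (- p) (Ev q k \<star> (Ev q j \<star> aw X (2 * (n - k - 1 - j)))))"
        by (rule sum.reindex_bij_witness[of _ "\<lambda>j. j + k" "\<lambda>i. i - k"]) (use k in auto)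
      also have "\<dots> = vscale (- p) (Ev q k \<star> ?H (n - k - 1))"
        by (simp only: star_sum_right fs.scale_sum_right)
      also have "\<dots> = vscale (- p) (Ev q k \<star> aw Y (Suc (2 * (n - k - 1))))"
        using less[of "n - k - 1"] k by simp
      finally show "(\<Sum>i\<in>{k..<n}. vscale (- p) (Ev q k \<star> (Ev q (i - k) \<star> aw X (2 * (n - Suc i)))))
        = vscale (- p) (Ev q k \<star> aw Y (Suc (2 * (n - k - 1))))" .
    qed simp
    also have "(\<Sum>i\<le>n. vscale p (Ev q i \<star> dl X (aw X (2 * (n - i)))))
      = (\<Sum>i<n. vscale p (Ev q i \<star> dl X (aw X (2 * (n - i)))))"
      by (simp flip: lessThan_Suc_atMost)
    also have "\<dots> = (\<Sum>i<n. vscale p (Ev q i \<star> aw Y (Suc (2 * (n - i - 1)))))"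
    proof (rule sum.cong)
      fix k assume "k \<in> {..<n}"
      then have "2 * (n - k) = Suc (Suc (2 * (n-k-1)))" by auto
      then show "vscale p (Ev q k \<star> dl X (aw X (2 * (n - k)))) = vscale p (Ev q k \<star> aw Y (Suc (2 * (n - k - 1))))"
        by simp
    qed simp
    finally have "dl X (?H n) = 0"
      by (simp add: sum_negf)
    moreover have "dl X (aw Y (Suc (2 * n)) :: word \<Rightarrow> 'a) = 0" by simp
    ultimately show "dl (other Y) (?H n) = dl (other Y) (aw Y (Suc (2 * n)))" by simp
  qed
qed

lemma Ev_Ualg: "Ev q n \<in> Ualg q"
proof (induction n rule: less_induct)
  case (less n)
  have "(\<Sum>i<n. Ev q i \<star> aw X (2 * (n - i))) + Ev q n = aw Y (Suc (2 * n))"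
    using Ev_even_sum[of n] by (simp flip: lessThan_Suc_atMost)
  then have "Ev q n = aw Y (Suc (2 * n)) - (\<Sum>i<n. Ev q i \<star> aw X (2 * (n - i)))"
    by (rule eq_diff_of_add_eq)
  also have "\<dots> \<in> Ualg q"
    using less aw_Ualg
    by (intro fs.subspace_diff[OF Ualg_subspace] fs.subspace_sum[OF Ualg_subspace] Ualg_star) auto
  finally show ?case .
qed

text \<open>Each factor adds at most one to the defect, and does so only when deleted completely; a
  prefix of maximal defect therefore uses up the total length.\<close>

lemma ld_eprod:
  assumes "ld s (eprod q \<nu>) \<noteq> 0"
  shows "defect s \<le> int (length \<nu>) \<and> (defect s = int (length \<nu>) \<longrightarrow> elen \<nu> \<le> length s)"
  using assms
proof (induction \<nu> arbitrary: s)
  case Nil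
  then have "s = []" using ld_homog_zero[OF homog_vone, of s] by (cases s) auto
  then show ?case by simp
next
  case (Cons n \<nu>)
  then obtain u t where ut: "length u + length t = length s" "defect u + defect t = defect s"
      "ld u (Ev q n) \<noteq> 0" "ld t (eprod q \<nu>) \<noteq> 0"
    by (auto elim: ld_star_nonzeroE)
  from Cons.IH[OF ut(4)] ld_Ev[OF ut(3)] ut(1,2) show ?case by auto
qed

lemma ld_eprod_short:
  assumes "ld s (eprod q \<nu>) \<noteq> 0" "length s < 2 * n + 1" "\<forall>m\<in>set \<nu>. n \<le> m"
  shows "defect s \<le> 0"
  using assms
proof (induction \<nu> arbitrary: s)
  case Nil
  then have "s = []" using ld_homog_zero[OF homog_vone, of s] by (cases s) auto
  then show ?case by simp
next
  case (Cons m \<nu>)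
  then obtain u t where ut: "length u + length t = length s" "defect u + defect t = defect s"
      "ld u (Ev q m) \<noteq> 0" "ld t (eprod q \<nu>) \<noteq> 0"
    by (auto elim: ld_star_nonzeroE)
  from Cons.IH[OF ut(4)] ld_Ev[OF ut(3)] ut(1,2) Cons.prems(2,3) show ?case by auto
qed

text \<open>The prefix is too short to exhaust anything but a single factor of index
  \<open>n\<close>. Each copy of that factor can supply it, after passing the copies to its left at
  the cost of \<open>q^2\<close> each, which gives the geometric sum. If \<open>n\<close> does not
  occur, the sum is empty and the value of \<open>tl\<close> is harmless.\<close>

lemma ld_eprod_min:
  assumes "sorted \<nu>" "\<forall>m\<in>set \<nu>. n \<le> m" "length u = 2 * n + 1" "defect u = 1"
  shows "ld u (eprod q \<nu>) = vscale (Ev q n u * (\<Sum>i<count_list \<nu> n. (q\<^sup>2) ^ i)) (eprod q (tl \<nu>))"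
  using assms(1,2)
proof (induction \<nu>)
  case Nil
  have "ld u vone = 0" using ld_homog_zero[OF homog_vone, of u] assms(3) by simp
  then show ?case by simp
next
  case (Cons m \<nu>)
  have "ld u (Ev q m \<star> eprod q \<nu>) = ld u (Ev q m) \<star> eprod q \<nu> + tw q (defect u) (Ev q m) \<star> ld u (eprod q \<nu>)"
  proof (rule ld_star_both)
    fix s t assume st: "length s + length t = length u" "defect s + defect t = defect u" "s \<noteq> []" "t \<noteq> []"
    then have len: "length s < 2 * n + 1" "length t < 2 * n + 1" using assms(3) by (cases s; cases t; simp)+
    show "ld s (Ev q m) = 0 \<or> ld t (eprod q \<nu>) = 0"
    proof (rule ccontr)
      assume a: "\<not> (ld s (Ev q m) = 0 \<or> ld t (eprod q \<nu>) = 0)"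
      then have "defect s \<le> 0" using ld_Ev[of s m] len Cons.prems by auto
      moreover have "defect t \<le> 0" using ld_eprod_short[of t \<nu> n] a len Cons.prems by auto
      ultimately show False using st assms by simp
    qed
  qed (use assms in auto)
  moreover have "ld u (Ev q m) = (if m = n then vscale (Ev q n u) vone else 0)"
  proof (cases "m = n")
    case True
    then show ?thesis using ld_homog_full[OF homog_Ev[of m q]] assms by simp
  next
    case False
    then show ?thesis using ld_Ev[of u m] assms by auto
  qed
  moreover have "tw q (defect u) (Ev q m) = vscale (q\<^sup>2) (Ev q m)"
    by (simp add: tw_Ev assms)
  ultimately have eq: "ld u (eprod q (m # \<nu>)) = (if m = n then vscale (Ev q n u) (eprod q \<nu>) else 0)
      + vscale (q\<^sup>2 * (Ev q n u * (\<Sum>i<count_list \<nu> n. (q\<^sup>2) ^ i))) (Ev q m \<star> eprod q (tl \<nu>))"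
    using Cons by auto
  show ?case
  proof (cases "m = n")
    case False
    then have "count_list \<nu> n = 0" using Cons.prems by (auto simp: count_list_0_iff)
    then show ?thesis using eq False by simp
  next
    case True
    show ?thesis
    proof (cases "count_list \<nu> n")
      case 0
      then show ?thesis using eq True by simp
    next
      case (Suc c)
      then have "n \<in> set \<nu>" by (metis count_notin nat.distinct(1))
      then obtain \<nu>' where \<nu>': "\<nu> = n # \<nu>'" using Cons.prems True by (cases \<nu>) fastforce+
      have "(\<Sum>i<count_list (m # \<nu>) n. (q\<^sup>2) ^ i) = 1 + q\<^sup>2 * (\<Sum>i<count_list \<nu> n. (q\<^sup>2) ^ i)"
        using True by (simp add: sum.lessThan_Suc_shift sum_distrib_left del: sum.lessThan_Suc)
      moreover have "Ev q m \<star> eprod q (tl \<nu>) = eprod q \<nu>" using \<nu>' True by simp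
      ultimately show ?thesis using eq True
        by (simp add: distrib_left mult.left_commute flip: fs.scale_left_distrib)
    qed
  qed
qed

lemma geometric_ne_0:
  assumes "p = q\<^sup>2 \<or> p = inverse (q\<^sup>2)"
  shows "(\<Sum>i<Suc n. p ^ i) \<noteq> 0"
proof
  assume "(\<Sum>i<Suc n. p ^ i) = 0"
  then have "p ^ Suc n = 1"
    using power_diff_1_eq[of p "Suc n"] by (simp del: sum.lessThan_Suc power_Suc)
  moreover have "q ^ (2 * Suc n) = (q\<^sup>2) ^ Suc n"
    by (simp only: power_mult)
  ultimately have "q ^ (2 * Suc n) = 1"
    using assms by (auto simp: power_inverse simp del: power_Suc)
  then show False using q_pow[of "2 * Suc n"] by simp
qed

lemma eprod_indep:
  assumes "finite F" "\<forall>\<nu>\<in>F. sorted \<nu>" "(\<Sum>\<nu>\<in>F. vscale (c \<nu>) (eprod q \<nu>)) = 0"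
  shows "\<forall>\<nu>\<in>F. c \<nu> = 0"
proof -
  have "\<forall>\<nu>\<in>F. length \<nu> < Suc (Max (insert 0 (length ` F)))"
    using assms(1) by (simp add: less_Suc_eq_le)
  then obtain N where "\<forall>\<nu>\<in>F. length \<nu> < N" by blast
  with assms show ?thesis
  proof (induction N arbitrary: F c)
    case (Suc N)
    define F' where "F' = {\<nu>\<in>F. c \<nu> \<noteq> 0}"
    have fin: "finite F'" using Suc.prems(1) by (simp add: F'_def)
    have sum': "(\<Sum>\<nu>\<in>F'. vscale (c \<nu>) (eprod q \<nu>)) = 0"
      unfolding F'_def Suc.prems(3)[symmetric] using Suc.prems(1) by (intro sum.mono_neutral_left) auto
    have "F' = {}"
    proof (rule ccontr)
      assume ne: "F' \<noteq> {}"
      \<comment> \<open>The minimum is taken over all lists together. A sorted list containing it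
        must begin with it, which makes \<open>tl\<close> injective on these lists.\<close>
      define S where "S = (\<Union>\<nu>\<in>F'. set \<nu>)"
      show False
      proof (cases "S = {}")
        case True
        then have "F' = {[]}" using ne by (auto simp: S_def)
        then have "vscale (c []) vone = 0" "c [] \<noteq> 0" using sum' by (auto simp: F'_def)
        then show False by (auto dest!: fun_cong[of _ _ "[]"] simp: pointwise)
      next
        case False
        define n where "n = Min S"
        have S: "finite S" using fin by (simp add: S_def)
        have n: "n \<in> S" "\<And>\<nu>. \<nu> \<in> F' \<Longrightarrow> \<forall>m\<in>set \<nu>. n \<le> m"
          using Min_in[OF S False] Min_le[OF S] by (auto simp: n_def S_def)
        define u where "u = alt X (2 * n) @ [Y]"
        have u: "length u = 2 * n + 1" "defect u = 1" "Ev q n u \<noteq> 0"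
          using Ev_nonzero[of n] by (simp_all add: u_def defect_alt)
        define G where "G = {\<nu>\<in>F'. n \<in> set \<nu>}"
        have G: "\<nu> = n # tl \<nu>" if "\<nu> \<in> G" for \<nu>
        proof -
          have "sorted \<nu>" "n \<in> set \<nu>" "\<forall>m\<in>set \<nu>. n \<le> m"
            using that Suc.prems(2) n(2) by (auto simp: G_def F'_def)
          then show ?thesis by (cases \<nu>) fastforce+
        qed
        define s where "s = (\<lambda>\<nu>. Ev q n u * (\<Sum>i<count_list \<nu> n. (q\<^sup>2) ^ i))"
        have ldu: "ld u (eprod q \<nu>) = vscale (s \<nu>) (eprod q (tl \<nu>))" if "\<nu> \<in> F'" for \<nu>
          unfolding s_def using Suc.prems(2) n(2) u that by (intro ld_eprod_min) (auto simp: F'_def)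
        have inj: "inj_on tl G"
          by (rule inj_onI) (metis G)
        have "0 = ld u (\<Sum>\<nu>\<in>F'. vscale (c \<nu>) (eprod q \<nu>))" using sum' by simp
        also have "\<dots> = (\<Sum>\<nu>\<in>F'. vscale (c \<nu> * s \<nu>) (eprod q (tl \<nu>)))"
          by (simp add: ld_sum ldu)
        also have "\<dots> = (\<Sum>\<nu>\<in>G. vscale (c \<nu> * s \<nu>) (eprod q (tl \<nu>)))"
          using fin by (intro sum.mono_neutral_right) (auto simp: G_def s_def count_list_0_iff)
        also have "\<dots> = (\<Sum>\<nu>\<in>G. vscale (c (n # tl \<nu>) * s (n # tl \<nu>)) (eprod q (tl \<nu>)))"
          by (rule sum.cong) (use G in auto)
        also have "\<dots> = (\<Sum>\<mu>\<in>tl ` G. vscale (c (n # \<mu>) * s (n # \<mu>)) (eprod q \<mu>))"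
          by (simp add: sum.reindex[OF inj])
        finally have "\<forall>\<mu>\<in>tl ` G. c (n # \<mu>) * s (n # \<mu>) = 0"
        proof (intro Suc.IH)
          show "\<forall>\<mu>\<in>tl ` G. sorted \<mu>"
            using Suc.prems(2) by (auto simp: G_def F'_def intro: sorted_tl)
          show "\<forall>\<mu>\<in>tl ` G. length \<mu> < N"
          proof clarify
            fix \<nu> assume \<nu>: "\<nu> \<in> G"
            then have "length \<nu> < Suc N" using Suc.prems(4) by (simp add: G_def F'_def)
            moreover have "length \<nu> = Suc (length (tl \<nu>))" using arg_cong[OF G[OF \<nu>], of length] by simp
            ultimately show "length (tl \<nu>) < N" by linarith
          qed
        qed (use fin in \<open>simp_all add: G_def\<close>)
        moreover obtain \<nu> where \<nu>: "\<nu> \<in> G" using n(1) by (auto simp: S_def G_def)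
        ultimately have "c \<nu> * s \<nu> = 0" using G[OF \<nu>] by (metis imageI)
        moreover have "c \<nu> \<noteq> 0" using \<nu> by (simp add: G_def F'_def)
        moreover obtain k where "count_list \<nu> n = Suc k"
          using \<nu> count_list_0_iff[of \<nu> n] by (cases "count_list \<nu> n") (auto simp: G_def)
        then have "s \<nu> \<noteq> 0"
          using u(3) geometric_ne_0[of "q\<^sup>2" k] unfolding s_def by simp
        ultimately show False by simp
      qed
    qed
    then show ?case by (auto simp: F'_def)
  qed simp
qed


section \<open>Iterated deletion of one letter from products of alternating words\<close>

lemma dl_pow_star:
  assumes "dl a (dl a u) = 0" "tw q (dg a) u = vscale e u"
  shows "(dl a ^^ Suc n) (u \<star> F) = vscale (e ^ Suc n) (u \<star> (dl a ^^ Suc n) F)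
    + vscale (e ^ n * (\<Sum>i<Suc n. inverse (q\<^sup>2) ^ i)) (dl a u \<star> (dl a ^^ n) F)"
proof -
  define p where "p = inverse (q\<^sup>2)"
  \<comment> \<open>The deleted letter carries the twist \<open>q^2\<close>, so
    \<open>dl a u\<close> has eigenvalue \<open>p * e\<close> where \<open>u\<close> has
    \<open>e\<close>. This ratio produces the geometric sum.\<close>
  have "vscale (q\<^sup>2) (tw q (dg a) (dl a u)) = dl a (tw q (dg a) u)"
    by (simp add: dl_tw[OF q0] mult.assoc)
  also have "\<dots> = vscale e (dl a u)" by (simp add: assms)
  finally have "vscale p (vscale (q\<^sup>2) (tw q (dg a) (dl a u))) = vscale p (vscale e (dl a u))"
    by simp
  then have t: "tw q (dg a) (dl a u) = vscale (p * e) (dl a u)"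
    using q0 by (simp add: p_def)
  have "(dl a ^^ Suc n) (u \<star> F) = vscale (e ^ Suc n) (u \<star> (dl a ^^ Suc n) F)
    + vscale (e ^ n * (\<Sum>i<Suc n. p ^ i)) (dl a u \<star> (dl a ^^ n) F)"
  proof (induction n)
    case 0
    show ?case by (simp add: assms add.commute)
  next
    case (Suc n)
    have "(dl a ^^ Suc (Suc n)) (u \<star> F) = dl a ((dl a ^^ Suc n) (u \<star> F))" by simp
    also have "\<dots> = vscale (e ^ Suc n) (dl a u \<star> (dl a ^^ Suc n) F)
        + vscale (e ^ Suc n * e) (u \<star> (dl a ^^ Suc (Suc n)) F)
        + vscale (e ^ n * (\<Sum>i<Suc n. p ^ i) * (p * e)) (dl a u \<star> (dl a ^^ Suc n) F)"
      unfolding Suc.IH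
      by (simp add: assms t fs.scale_right_distrib del: funpow.simps sum.lessThan_Suc power_Suc)
        (simp add: add.assoc)
    also have "\<dots> = vscale (e ^ Suc (Suc n)) (u \<star> (dl a ^^ Suc (Suc n)) F)
        + vscale (e ^ Suc n + e ^ n * (\<Sum>i<Suc n. p ^ i) * (p * e)) (dl a u \<star> (dl a ^^ Suc n) F)"
      by (simp only: fs.scale_left_distrib power_Suc2 add.assoc add.left_commute)
    also have "e ^ Suc n + e ^ n * (\<Sum>i<Suc n. p ^ i) * (p * e) = e ^ Suc n * (\<Sum>i<Suc (Suc n). p ^ i)"
      by (subst (2) sum.lessThan_Suc_shift) (simp add: sum_distrib_left algebra_simps del: sum.lessThan_Suc)
    finally show ?case .
  qed
  then show ?thesis by (simp only: p_def)
qed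

definition npos :: "nat list \<Rightarrow> nat" where
  "npos T = length (filter (\<lambda>n. 0 < n) T)"

lemma npos_simps [simp]: "npos [] = 0" "npos (0 # T) = npos T" "npos (Suc k # T) = Suc (npos T)"
  by (simp_all add: npos_def)

text \<open>A factor that has given up its first letter \<open>a\<close> begins with the other
  letter or is empty, so it supplies \<open>a\<close> only once. Deleting \<open>a\<close> once per
  nonempty factor therefore strips all of them. In \<open>n - 1\<close> truncated subtraction keeps
  the padding zeros at zero.\<close>

lemma aprod_dl_gt: "n > npos T \<Longrightarrow> (dl a ^^ n) (aprod q a T) = 0"
  and aprod_dl_eq: "\<exists>\<kappa>. \<kappa> \<noteq> 0 \<and> (dl a ^^ npos T) (aprod q a T) = vscale \<kappa> (aprod q (other a) (map (\<lambda>n. n - 1) T))"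
proof (induction T arbitrary: n)
  case Nil
  { case 1 then show ?case by (simp add: dl_pow_vone) }
  { case 2 show ?case by (rule exI[of _ 1]) simp }
next
  case (Cons k T)
  have e: "\<exists>e. e \<noteq> 0 \<and> tw q (dg a) (aw a k) = vscale e (aw a k)" for k
    using homog_tw_eq[OF homog_aw, of q "dg a" a k] q0
    by (intro exI[of _ "q powi (2 * (if even k then 0 else dg a) * dg a)"] conjI) simp_all
  { case 1
    show ?case
    proof (cases k)
      case 0
      then show ?thesis using Cons.IH(1)[of n] 1 by simp
    next
      case (Suc j)
      obtain m where n: "n = Suc m" "m > npos T" using 1 Suc by (cases n) auto
      obtain e where "tw q (dg a) (aw a k) = vscale e (aw a k)" using e by blast
      from dl_pow_star[OF _ this, of m "aprod q a T"] show ?thesis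
        using Cons.IH(1)[of m] Cons.IH(1)[of n] n Suc by simp
    qed }
  { case 2
    show ?case
    proof (cases k)
      case 0
      then show ?thesis using Cons.IH(2) by simp
    next
      case (Suc j)
      obtain e where e: "e \<noteq> 0" "tw q (dg a) (aw a k) = vscale e (aw a k)" using e by blast
      obtain \<kappa> where \<kappa>: "\<kappa> \<noteq> 0" "(dl a ^^ npos T) (aprod q a T) = vscale \<kappa> (aprod q (other a) (map (\<lambda>n. n - 1) T))"
        using Cons.IH(2) by blast
      define m where "m = npos T"
      define g where "g = (\<Sum>i<Suc m. inverse (q\<^sup>2) ^ i)"
      have g: "g \<noteq> 0" unfolding g_def by (rule geometric_ne_0) simp
      have "dl a (dl a (aw a k)) = 0" using Suc by simp
      from dl_pow_star[OF this e(2), of m "aprod q a T"]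
      have "(dl a ^^ Suc m) (aprod q a (k # T)) = vscale (e ^ m * g * \<kappa>) (aprod q (other a) (map (\<lambda>n. n - 1) (k # T)))"
        unfolding g_def[symmetric]
        using Cons.IH(1)[of "Suc m"] \<kappa>(2) Suc by (simp add: m_def del: funpow.simps)
      moreover have "e ^ m * g * \<kappa> \<noteq> 0" using e(1) g \<kappa>(1) by simp
      moreover have "npos (k # T) = Suc m" using Suc by (simp add: m_def)
      ultimately show ?thesis by metis
    qed }
qed

text \<open>Taking predecessors sends both 0 and 1 to 0. Knowing the length and the number of
  positive entries removes this ambiguity, because a descending list has its zeros at the
  end.\<close>

lemma desc_decomp:
  assumes "sorted_wrt (\<ge>) T"
  shows "\<exists>P. length P = npos T \<and> T = map Suc P @ replicate (length T - npos T) 0"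
  using assms
proof (induction T)
  case (Cons k T)
  then obtain P where P: "length P = npos T" "T = map Suc P @ replicate (length T - npos T) 0" by auto
  show ?case
  proof (cases k)
    case 0
    then have "\<forall>m\<in>set T. m = 0" using Cons.prems by auto
    then have "npos T = 0" "T = replicate (length T) 0"
      by (auto simp: npos_def filter_empty_conv intro: replicate_eqI)
    then show ?thesis using 0 by (intro exI[of _ "[]"]) simp
  next
    case (Suc j)
    then show ?thesis using P by (intro exI[of _ "j # P"]) simp
  qed
qed simp

lemma aprod_zeros: "npos T = 0 \<Longrightarrow> aprod q a T = vone"
  by (induction T) (auto simp: npos_def split: if_splits)

text \<open>Factors that become empty stay in the list as zeros, so stripping preserves the common
  length \<open>m\<close> and can be undone. Lists with the most positive entries survive the
  deletion and the rest vanish. The sum of the entries drops by that number, and the first letter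
  changes, whence \<open>a\<close> is arbitrary in the induction.\<close>

lemma aprod_indep_fixed:
  assumes "finite F" "\<forall>T\<in>F. sorted_wrt (\<ge>) T \<and> length T = m"
    "(\<Sum>T\<in>F. vscale (c T) (aprod q a T)) = 0"
  shows "\<forall>T\<in>F. c T = 0"
proof -
  have "\<forall>T\<in>F. sum_list T < Suc (Max (insert 0 (sum_list ` F)))"
    using assms(1) by (simp add: less_Suc_eq_le)
  then obtain N where "\<forall>T\<in>F. sum_list T < N" by blast
  with assms show ?thesis
  proof (induction N arbitrary: F c a)
    case (Suc N)
    define F' where "F' = {T\<in>F. c T \<noteq> 0}"
    have fin: "finite F'" using Suc.prems(1) by (simp add: F'_def)
    have sum': "(\<Sum>T\<in>F'. vscale (c T) (aprod q a T)) = 0"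
      unfolding F'_def Suc.prems(3)[symmetric] using Suc.prems(1) by (intro sum.mono_neutral_left) auto
    have "F' = {}"
    proof (rule ccontr)
      assume ne: "F' \<noteq> {}"
      define r where "r = Max (npos ` F')"
      have r: "r \<in> npos ` F'" "\<And>T. T \<in> F' \<Longrightarrow> npos T \<le> r"
        using ne fin by (simp_all add: r_def)
      define G where "G = {T\<in>F'. npos T = r}"
      have G: "\<exists>P. length P = r \<and> T = map Suc P @ replicate (m - r) 0" if "T \<in> G" for T
        using desc_decomp[of T] that Suc.prems(2) by (auto simp: G_def F'_def)
      define pre where "pre = map (\<lambda>n::nat. n - 1)"
      have pre: "map Suc (take r (pre T)) @ replicate (m - r) 0 = T" if "T \<in> G" for T
        using G[OF that] by (auto simp: pre_def o_def)
      have inj: "inj_on pre G"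
        by (rule inj_onI) (metis pre)
      obtain T0 where T0: "T0 \<in> G" using r(1) by (auto simp: G_def)
      show False
      proof (cases "r = 0")
        case True
        have "F' = {T0}"
        proof -
          have "T = replicate m 0" if "T \<in> F'" for T
            using G[of T] that r(2)[OF that] True by (auto simp: G_def)
          then show ?thesis using T0 unfolding G_def by blast
        qed
        then have "vscale (c T0) vone = 0" "c T0 \<noteq> 0"
          using sum' T0 aprod_zeros[of T0 a] True by (auto simp: G_def F'_def)
        then show False by (auto dest!: fun_cong[of _ _ "[]"] simp: pointwise)
      next
        case False
        define \<kappa> where "\<kappa> = (\<lambda>T. SOME \<kappa>. \<kappa> \<noteq> 0 \<and> (dl a ^^ npos T) (aprod q a T) = vscale \<kappa> (aprod q (other a) (map (\<lambda>n. n - 1) T)))"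
        have \<kappa>: "\<kappa> T \<noteq> 0" "(dl a ^^ npos T) (aprod q a T) = vscale (\<kappa> T) (aprod q (other a) (pre T))" for T
          using someI_ex[OF aprod_dl_eq[of T a]] unfolding \<kappa>_def pre_def by blast+
        have "0 = (dl a ^^ r) (\<Sum>T\<in>F'. vscale (c T) (aprod q a T))" using sum' by simp
        also have "\<dots> = (\<Sum>T\<in>F'. vscale (c T) ((dl a ^^ r) (aprod q a T)))"
          by (simp add: dl_pow_sum)
        also have "\<dots> = (\<Sum>T\<in>G. vscale (c T) ((dl a ^^ r) (aprod q a T)))"
        proof (rule sum.mono_neutral_right)
          show "\<forall>T\<in>F' - G. vscale (c T) ((dl a ^^ r) (aprod q a T)) = 0"
            using r(2) aprod_dl_gt by (fastforce simp: G_def)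
        qed (use fin in \<open>auto simp: G_def\<close>)
        also have "\<dots> = (\<Sum>T\<in>G. vscale (c T * \<kappa> T) (aprod q (other a) (pre T)))"
          by (rule sum.cong) (use \<kappa>(2) in \<open>auto simp: G_def\<close>)
        also have "\<dots> = (\<Sum>T\<in>G. vscale ((\<lambda>S. c (inv_into G pre S) * \<kappa> (inv_into G pre S)) (pre T)) (aprod q (other a) (pre T)))"
          by (rule sum.cong) (simp_all add: inv_into_f_f[OF inj])
        also have "\<dots> = (\<Sum>S\<in>pre ` G. vscale (c (inv_into G pre S) * \<kappa> (inv_into G pre S)) (aprod q (other a) S))"
          by (simp add: sum.reindex[OF inj])
        finally have "\<forall>S\<in>pre ` G. c (inv_into G pre S) * \<kappa> (inv_into G pre S) = 0"
        proof (intro Suc.IH[of "pre ` G" _ "other a"])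
          show "\<forall>S\<in>pre ` G. sorted_wrt (\<ge>) S \<and> length S = m"
          proof
            fix S assume "S \<in> pre ` G"
            then obtain T where T: "S = pre T" "T \<in> F" by (auto simp: G_def F'_def)
            then have "sorted_wrt (\<lambda>x y. x - 1 \<ge> y - 1) T"
              using Suc.prems(2) by (auto intro: sorted_wrt_mono_rel[of T "(\<ge>)"])
            then show "sorted_wrt (\<ge>) S \<and> length S = m"
              using T Suc.prems(2) by (simp add: pre_def sorted_wrt_map)
          qed
          show "\<forall>S\<in>pre ` G. sum_list S < N"
          proof
            fix S assume "S \<in> pre ` G"
            then obtain T where T: "S = pre T" "T \<in> G" by auto
            obtain P where P: "length P = r" "T = map Suc P @ replicate (m - r) 0" using G[OF T(2)] by blast
            have "sum_list (map Suc P) = sum_list P + length P" by (induction P) auto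
            then have "sum_list T = sum_list P + r" "sum_list S = sum_list P"
              using P T by (auto simp: pre_def o_def sum_list_replicate)
            moreover have "sum_list T < Suc N" using Suc.prems(4) T(2) by (auto simp: G_def F'_def)
            ultimately show "sum_list S < N" using False by simp
          qed
        qed (use fin in \<open>simp_all add: G_def\<close>)
        then have "c T0 * \<kappa> T0 = 0" using T0 inv_into_f_f[OF inj T0] by (metis imageI)
        then show False using \<kappa>(1)[of T0] T0 by (simp add: G_def F'_def)
      qed
    qed
    then show ?case by (auto simp: F'_def)
  qed simp
qed

lemma aprod_append_zeros: "aprod q a (T @ replicate k 0) = aprod q a T"
proof (induction T)
  case Nil
  show ?case using aprod_zeros[of "replicate k 0" a] by (simp add: npos_def)
qed simp

lemma aprod_indep:
  assumes "finite F" "\<forall>T\<in>F. sorted_wrt (\<ge>) T \<and> 0 \<notin> set T"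
    "(\<Sum>T\<in>F. vscale (c T) (aprod q a T)) = 0"
  shows "\<forall>T\<in>F. c T = 0"
proof -
  define m where "m = Max (insert 0 (length ` F))"
  have m: "length T \<le> m" if "T \<in> F" for T
    using that assms(1) by (simp add: m_def)
  \<comment> \<open>Padding with units brings all lists to one length without changing the products;
    \<open>un\<close> undoes it.\<close>
  define pad where "pad = (\<lambda>T. T @ replicate (m - length T) (0::nat))"
  define un where "un = filter (\<lambda>n::nat. 0 < n)"
  have un: "un (pad T) = T" if "T \<in> F" for T
    using assms(2) that by (auto simp: un_def pad_def filter_id_conv intro: gr0I)
  have inj: "inj_on pad F" by (rule inj_onI) (metis un)
  have "(\<Sum>S\<in>pad ` F. vscale (c (un S)) (aprod q a S)) = (\<Sum>T\<in>F. vscale (c T) (aprod q a T))"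
    by (simp add: sum.reindex[OF inj] un) (simp add: pad_def aprod_append_zeros)
  then have "(\<Sum>S\<in>pad ` F. vscale (c (un S)) (aprod q a S)) = 0" using assms(3) by simp
  then have "\<forall>S\<in>pad ` F. c (un S) = 0"
  proof (intro aprod_indep_fixed)
    have "sorted_wrt (\<ge>) (replicate k (0::nat))" for k by (induction k) auto
    then show "\<forall>S\<in>pad ` F. sorted_wrt (\<ge>) S \<and> length S = m"
      using assms(2) m by (auto simp: pad_def sorted_wrt_append)
  qed (use assms(1) in simp_all)
  then show ?thesis using un by simp
qed

section \<open>Alternating words starting with \<open>X\<close> combined with the elements
  \<open>Ev\<close>\<close>

lemma ld_aprod:
  assumes "ld s (aprod q X T) \<noteq> 0"
  shows "defect s \<le> 0"
  using assms
proof (induction T arbitrary: s)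
  case Nil
  then have "s = []" using ld_homog_zero[OF homog_vone, of s] by (cases s) auto
  then show ?case by simp
next
  case (Cons n T)
  then obtain u t where ut: "length u + length t = length s" "defect u + defect t = defect s"
      "ld u (aw X n :: word \<Rightarrow> 'a) \<noteq> 0" "ld t (aprod q X T) \<noteq> 0"
    by (auto elim: ld_star_nonzeroE)
  from ut(3) obtain w where w: "alt X n = u @ w"
    unfolding ld_def aw_def wsingle_def fun_eq_iff by (auto simp: pointwise) metis
  have "u = take (length u) (alt X n)" unfolding w by simp
  moreover have "take k (alt a n) = alt a (min k n)" for k a
    by (induction n arbitrary: a k) (auto split: nat.split simp: take_Cons min_def)
  ultimately obtain j where "u = alt X j" by metis
  then have "defect u \<le> 0" by (simp add: defect_alt)
  with Cons.IH[OF ut(4)] ut(2) show ?case by simp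
qed

lemma aprod_eprod_indep:
  assumes "finite F" "\<forall>(T, \<nu>)\<in>F. sorted_wrt (\<ge>) T \<and> 0 \<notin> set T \<and> sorted \<nu>"
    "(\<Sum>(T, \<nu>)\<in>F. vscale (c T \<nu>) (aprod q X T \<star> eprod q \<nu>)) = 0"
  shows "\<forall>(T, \<nu>)\<in>F. c T \<nu> = 0"
proof -
  define F' where "F' = {(T, \<nu>)\<in>F. c T \<nu> \<noteq> 0}"
  have fin: "finite F'" by (rule finite_subset[OF _ assms(1)]) (auto simp: F'_def)
  have sum': "(\<Sum>(T, \<nu>)\<in>F'. vscale (c T \<nu>) (aprod q X T \<star> eprod q \<nu>)) = 0"
    unfolding assms(3)[symmetric] using assms(1) by (intro sum.mono_neutral_left) (auto simp: F'_def)
  have "F' = {}"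
  proof (rule ccontr)
    assume ne: "F' \<noteq> {}"
    define a where "a = Max (length ` snd ` F')"
    have a: "a \<in> length ` snd ` F'" "\<And>T \<nu>. (T, \<nu>) \<in> F' \<Longrightarrow> length \<nu> \<le> a"
      using ne fin unfolding a_def by (intro Max_in, auto intro!: Max_ge rev_image_eqI)
    define L where "L = elen ` {\<nu> \<in> snd ` F'. length \<nu> = a}"
    have L: "finite L" "L \<noteq> {}" using fin a(1) by (auto simp: L_def)
    define l where "l = Min L"
    have l: "l \<in> L" "\<And>T \<nu>. (T, \<nu>) \<in> F' \<Longrightarrow> length \<nu> = a \<Longrightarrow> l \<le> elen \<nu>"
      using Min_in[OF L] L(1) unfolding l_def by (auto intro!: Min_le rev_image_eqI simp: L_def)
    define N where "N = (\<lambda>T \<nu>. (T, \<nu>) \<in> F' \<and> length \<nu> = a \<and> elen \<nu> = l)"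
    define A where "A = fst ` F'"
    define B where "B = snd ` F'"
    define c' where "c' = (\<lambda>T \<nu>. if N T \<nu> then c T \<nu> else 0)"
    have AB: "finite A" "finite B" "F' \<subseteq> A \<times> B" using fin by (force simp: A_def B_def)+
    \<comment> \<open>Each prefix \<open>u\<close> of length \<open>l\<close> and defect
      \<open>a\<close> gives a relation among the \<open>aprod\<close>, whose coefficients must
      vanish. Words of another length or defect contribute nothing by homogeneity, so for each
      \<open>T\<close> a full relation among the \<open>eprod\<close> results.\<close>
    have key: "(\<Sum>\<nu>\<in>B. c' T \<nu> * eprod q \<nu> u) = 0" if T: "T \<in> A" for u T
    proof (cases "length u = l \<and> defect u = int a")
      case False
      have "c' T \<nu> * eprod q \<nu> u = 0" for \<nu>
        using False homog_eprod[of \<nu> q] by (auto simp: c'_def N_def homog_def)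
      then show ?thesis by (simp add: sum.neutral)
    next
      case True
      have ldu: "ld u (aprod q X T \<star> eprod q \<nu>) = (if N T \<nu> then vscale (eprod q \<nu> u) (tw q (defect u) (aprod q X T)) else 0)"
        if mem: "(T, \<nu>) \<in> F'" for T \<nu>
      proof -
        \<comment> \<open>A nonempty part of the prefix taken from the \<open>X\<close>-words has
          defect at most 0; the rest would have to reach defect \<open>a\<close> with fewer than
          \<open>l\<close> letters.\<close>
        have "ld u (aprod q X T \<star> eprod q \<nu>) = tw q (defect u) (aprod q X T) \<star> ld u (eprod q \<nu>)"
        proof (rule ld_star_right)
          fix s t :: word assume st: "length s + length t = length u" "defect s + defect t = defect u" "s \<noteq> []"
          show "ld s (aprod q X T) = 0 \<or> ld t (eprod q \<nu>) = 0"
          proof (rule ccontr)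
            assume "\<not> (ld s (aprod q X T) = 0 \<or> ld t (eprod q \<nu>) = 0)"
            then have "defect s \<le> 0" "defect t \<le> int (length \<nu>)"
              "defect t = int (length \<nu>) \<longrightarrow> elen \<nu> \<le> length t"
              using ld_aprod[of s T] ld_eprod[of t \<nu>] by auto
            moreover have "length \<nu> \<le> a" using a(2) mem by blast
            ultimately have "length \<nu> = a" "elen \<nu> \<le> length t" using st True by auto
            then have "l \<le> length t" using l(2)[OF mem] by simp
            then show False using st True by (cases s) auto
          qed
        qed
        moreover have "ld u (eprod q \<nu>) = (if N T \<nu> then vscale (eprod q \<nu> u) vone else 0)"
        proof (cases "N T \<nu>")
          case N: True
          then show ?thesis using ld_homog_full[OF homog_eprod[of \<nu> q], of u] True by (simp add: N_def)
        next
          case N: False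
          have "ld u (eprod q \<nu>) = 0"
          proof (rule ccontr)
            assume "ld u (eprod q \<nu>) \<noteq> 0"
            from ld_eprod[OF this] have "length \<nu> = a" "elen \<nu> \<le> l" using a(2)[OF mem] True by auto
            then show False using N mem l(2)[OF mem] by (simp add: N_def)
          qed
          then show ?thesis using N by simp
        qed
        ultimately show ?thesis by simp
      qed
      have "0 = ld u (\<Sum>(T, \<nu>)\<in>F'. vscale (c T \<nu>) (aprod q X T \<star> eprod q \<nu>))" using sum' by simp
      also have "\<dots> = (\<Sum>(T, \<nu>)\<in>F'. vscale (c T \<nu>) (ld u (aprod q X T \<star> eprod q \<nu>)))"
        by (simp add: ld_sum case_prod_beta)
      also have "\<dots> = (\<Sum>(T, \<nu>)\<in>F'. vscale (c' T \<nu> * eprod q \<nu> u) (tw q (defect u) (aprod q X T)))"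
        by (rule sum.cong) (auto simp: ldu c'_def)
      also have "\<dots> = (\<Sum>(T, \<nu>)\<in>A \<times> B. vscale (c' T \<nu> * eprod q \<nu> u) (tw q (defect u) (aprod q X T)))"
        using AB by (intro sum.mono_neutral_left) (auto simp: c'_def N_def)
      also have "\<dots> = (\<Sum>T\<in>A. \<Sum>\<nu>\<in>B. vscale (c' T \<nu> * eprod q \<nu> u) (tw q (defect u) (aprod q X T)))"
        by (rule sum.cartesian_product[symmetric])
      also have "\<dots> = tw q (defect u) (\<Sum>T\<in>A. vscale (\<Sum>\<nu>\<in>B. c' T \<nu> * eprod q \<nu> u) (aprod q X T))"
        by (simp add: tw_sum fs.scale_sum_left)
      finally have "tw q (defect u) (\<Sum>T\<in>A. vscale (\<Sum>\<nu>\<in>B. c' T \<nu> * eprod q \<nu> u) (aprod q X T)) = 0"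
        by (rule sym)
      then have "(\<Sum>T\<in>A. vscale (\<Sum>\<nu>\<in>B. c' T \<nu> * eprod q \<nu> u) (aprod q X T)) = 0"
        by (simp only: tw_eq_0_iff[OF q0])
      then have "\<forall>T\<in>A. (\<Sum>\<nu>\<in>B. c' T \<nu> * eprod q \<nu> u) = 0"
        using assms(2) AB by (intro aprod_indep) (auto simp: A_def F'_def)
      then show ?thesis using T by blast
    qed
    from l(1) obtain T \<nu> where T: "(T, \<nu>) \<in> F'" "N T \<nu>" by (auto simp: L_def N_def)
    then have TB: "T \<in> A" "\<nu> \<in> B" using AB(3) by auto
    have "(\<Sum>\<nu>\<in>B. vscale (c' T \<nu>) (eprod q \<nu>)) = 0"
      by (simp add: fun_eq_iff sum_apply pointwise key[OF TB(1)])
    then have "\<forall>\<nu>\<in>B. c' T \<nu> = 0"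
      using assms(2) AB by (intro eprod_indep) (auto simp: B_def F'_def)
    then have "c T \<nu> = 0" using T(2) TB(2) by (auto simp: c'_def)
    then show False using T(1) by (simp add: F'_def)
  qed
  then show ?thesis by (auto simp: F'_def)
qed

end

section \<open>Ordered monomials\<close>

text \<open>In a given shuffle each pair of letters, one from \<open>f\<close> and one from
  \<open>g\<close>, is crossed in exactly one of the two readings \<open>f\<close>, \<open>g\<close>
  and \<open>g\<close>, \<open>f\<close>. The two exponents thus add up to the total pairing
  \<open>2 * d * d'\<close>, and inverting \<open>q\<close> turns one into the other up to this
  power.\<close>

lemma star_inverse:
  assumes q: "q \<noteq> 0" and "homog l d f" "homog l' d' g"
  shows "star q f g = vscale (q powi (2 * d * d')) (star (inverse q) g f)"
proof
  fix w
  show "star q f g w = vscale (q powi (2 * d * d')) (star (inverse q) g f) w"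
    using assms(2,3)
  proof (induction w arbitrary: f g l d l' d')
    case Nil
    show ?case
    proof (cases "f [] * g [] = 0")
      case False
      then have "d = 0" using Nil by (force simp: homog_def)
      then show ?thesis by (simp add: pointwise)
    qed (simp add: pointwise mult.commute)
  next
    case (Cons a w)
    have i: "inverse q powi z = q powi (- z)" for z
      by (simp add: power_int_minus power_int_inverse)
    have "star q f g (a # w) = star q (dl a f) g w + q powi (2 * d * dg a) * star q f (dl a g) w"
      by (simp add: homog_tw_eq[OF Cons.prems(1)] pointwise)
    also have "\<dots> = q powi (2 * (d - dg a) * d') * star (inverse q) g (dl a f) w
       + q powi (2 * d * dg a) * (q powi (2 * d * (d' - dg a)) * star (inverse q) (dl a g) f w)"
      using Cons.IH[OF homog_dl[OF Cons.prems(1)] Cons.prems(2)]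
        Cons.IH[OF Cons.prems(1) homog_dl[OF Cons.prems(2)]] by (simp add: pointwise)
    also have "\<dots> = q powi (2 * d * d') * (q powi (- (2 * d' * dg a)) * star (inverse q) g (dl a f) w
       + star (inverse q) (dl a g) f w)"
      using q by (simp add: distrib_left mult.assoc[symmetric] power_int_add[symmetric]) (simp add: algebra_simps)
    also have "\<dots> = vscale (q powi (2 * d * d')) (star (inverse q) g f) (a # w)"
      by (simp add: homog_tw_eq[OF Cons.prems(2)] pointwise i add.commute)
    finally show ?case .
  qed
qed

lemma homog_sprod:
  assumes "\<And>f. f \<in> set fs \<Longrightarrow> \<exists>l d. homog l d f"
  shows "\<exists>l d. homog l d (sprod q fs)"
  using assms
proof (induction fs)
  case (Cons f fs)
  then show ?case using homog_star by (metis list.set_intros sprod_simps(2))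
qed (use homog_vone in auto)

lemma qshuf_inverse: "qshuf q \<Longrightarrow> qshuf (inverse q)"
  by (simp add: qshuf_def power_inverse)

lemma span_familyE:
  assumes "f \<in> fs.span (b ` I)"
  obtains F c where "finite F" "F \<subseteq> I" "f = (\<Sum>i\<in>F. vscale (c i) (b i))"
proof -
  have "\<exists>F c. finite F \<and> F \<subseteq> I \<and> f = (\<Sum>i\<in>F. vscale (c i) (b i))"
    using assms
  proof (induction rule: fs.span_induct_alt)
    case base
    show ?case by (rule exI[of _ "{}"]) (simp add: zero_fun_def)
  next
    case (step c x y)
    then obtain F c0 i where F: "finite F" "F \<subseteq> I" "y = (\<Sum>i\<in>F. vscale (c0 i) (b i))" "i \<in> I" "x = b i"
      by auto
    define c' where "c' = (\<lambda>j. (if j \<in> F then c0 j else 0) + (if j = i then c else 0))"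
    have "(\<Sum>j\<in>insert i F. vscale (c' j) (b j)) = (\<Sum>j\<in>insert i F. vscale (if j \<in> F then c0 j else 0) (b j))
       + (\<Sum>j\<in>insert i F. vscale (if j = i then c else 0) (b j))"
      by (simp only: c'_def fs.scale_left_distrib sum.distrib)
    also have "(\<Sum>j\<in>insert i F. vscale (if j \<in> F then c0 j else 0) (b j)) = y"
      unfolding F(3) using F(1) by (intro sum.mono_neutral_cong_right) auto
    also have "(\<Sum>j\<in>insert i F. vscale (if j = i then c else 0) (b j)) = (\<Sum>j\<in>{i}. vscale c (b j))"
      using F(1) by (intro sum.mono_neutral_cong_right) auto
    finally have "vscale c x + y = (\<Sum>j\<in>insert i F. vscale (c' j) (b j))"
      by (simp add: F(5) add.commute)
    then show ?case using F by (intro exI[of _ "insert i F"] exI[of _ c']) simp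
  qed
  then show ?thesis using that by blast
qed

text \<open>A relation with \<open>c i0\<close> nonzero would make the span of the
  \<open>b i\<close> generated by fewer than \<open>card I\<close> elements, although it contains
  \<open>card I\<close> independent ones. Indexed families are used because distinct indices might a
  priori have equal \<open>b i\<close>.\<close>

lemma independent_family_transfer:
  fixes J b :: "'i \<Rightarrow> word \<Rightarrow> 'a::field"
  assumes fin: "finite I" and span: "\<And>i. i \<in> I \<Longrightarrow> J i \<in> fs.span (b ` I)"
    and indep: "\<And>c. (\<Sum>i\<in>I. vscale (c i) (J i)) = 0 \<Longrightarrow> \<forall>i\<in>I. c i = 0"
    and rel: "(\<Sum>i\<in>I. vscale (c i) (b i)) = 0" and i0: "i0 \<in> I"
  shows "c i0 = 0"
proof (rule ccontr)
  assume c0: "c i0 \<noteq> 0"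
  have inj: "inj_on J I"
  proof (rule inj_onI, rule ccontr)
    fix i j assume ij: "i \<in> I" "j \<in> I" "J i = J j" "i \<noteq> j"
    define c where "c = (\<lambda>k. if k = i then 1 else if k = j then - 1 else (0::'a))"
    have "(\<Sum>k\<in>I. vscale (c k) (J k)) = (\<Sum>k\<in>{i, j}. vscale (c k) (J k))"
      using fin ij by (intro sum.mono_neutral_right) (auto simp: c_def)
    also have "\<dots> = 0" using ij by (simp add: c_def)
    finally show False using indep ij by (force simp: c_def)
  qed
  have "fs.independent (J ` I)"
  proof
    assume "fs.dependent (J ` I)"
    then obtain u v where u: "v \<in> I" "u (J v) \<noteq> 0" "(\<Sum>x\<in>J ` I. vscale (u x) x) = 0"
      using fin by (auto simp: fs.dependent_finite)
    from u(3) have "(\<Sum>i\<in>I. vscale (u (J i)) (J i)) = 0" by (simp add: sum.reindex[OF inj])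
    from indep[OF this] u show False by blast
  qed
  moreover have "b i0 \<in> fs.span (b ` (I - {i0}))"
  proof -
    have "vscale (c i0) (b i0) + (\<Sum>i\<in>I - {i0}. vscale (c i) (b i)) = 0"
      using rel by (simp add: sum.remove[OF fin i0])
    then have "vscale (c i0) (b i0) = - (\<Sum>i\<in>I - {i0}. vscale (c i) (b i))"
      by (rule eq_neg_iff_add_eq_0[THEN iffD2])
    also have "\<dots> \<in> fs.span (b ` (I - {i0}))"
      by (intro fs.span_neg fs.span_sum fs.span_scale fs.span_base imageI)
    finally have "vscale (inverse (c i0)) (vscale (c i0) (b i0)) \<in> fs.span (b ` (I - {i0}))"
      by (rule fs.span_scale)
    then show ?thesis using c0 by simp
  qed
  then have "fs.span (b ` I) \<subseteq> fs.span (b ` (I - {i0}))"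
    by (intro fs.span_minimal) (auto intro: fs.span_base)
  then have "J ` I \<subseteq> fs.span (b ` (I - {i0}))" using span by blast
  ultimately have "card (J ` I) \<le> card (b ` (I - {i0}))"
    using fs.independent_span_bound[of "b ` (I - {i0})" "J ` I"] fin by simp
  also have "\<dots> \<le> card (I - {i0})" by (rule card_image_le) (use fin in simp)
  also have "\<dots> < card I" by (rule card_Diff1_less[OF fin i0])
  finally show False using card_image[OF inj] by simp
qed

section \<open>Monomials indexed by lists over \<open>omega\<close>, and the six block
  orders\<close>

lemma omega_elt_aw:
  "omega_elt (Wneg i) = aw X (Suc (2 * i))" "omega_elt (Gt j) = aw X (2 * Suc j)"
  "omega_elt (Wpos k) = aw Y (Suc (2 * k))"
  by (simp_all add: omega_elt_def aw_def)

lemma oddX_omega: "oddw X = omega_elt ` range Wneg"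
  by (simp add: oddw_def image_image omega_elt_aw)

lemma oddY_omega: "oddw Y = omega_elt ` range Wpos"
  by (simp add: oddw_def image_image omega_elt_aw)

lemma evenX_omega: "(evenw X :: (word \<Rightarrow> 'a::field) set) = insert vone (omega_elt ` range Gt)"
proof
  have "(aw X (2 * k) :: word \<Rightarrow> 'a) \<in> insert vone (omega_elt ` range Gt)" for k
    by (cases k) (auto simp flip: omega_elt_aw simp del: mult_Suc_right)
  then show "(evenw X :: (word \<Rightarrow> 'a) set) \<subseteq> insert vone (omega_elt ` range Gt)" by (auto simp: evenw_def)
  have "vone = (aw X (2 * 0) :: word \<Rightarrow> 'a)" by simp
  also have "\<dots> \<in> evenw X" unfolding evenw_def by (rule rangeI)
  finally show "insert vone (omega_elt ` range Gt) \<subseteq> (evenw X :: (word \<Rightarrow> 'a) set)"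
    by (auto simp: evenw_def omega_elt_aw simp del: mult_Suc_right)
qed

definition olen :: "omega list \<Rightarrow> nat" where
  "olen as = (\<Sum>a\<leftarrow>as. length (omega_word a))"

lemma homog_omega: "\<exists>d. homog (int (length (omega_word a))) d (omega_elt a)"
  unfolding omega_elt_def using homog_wsingle by blast

lemma omega_prod_sprod: "omega_prod q as = sprod q (map omega_elt as)
    \<and> (\<exists>d. homog (int (olen as)) d (omega_prod q as))"
proof (induction as)
  case Nil
  then show ?case using homog_vone by (auto simp: omega_prod_def olen_def)
next
  case (Cons a as)
  obtain d d' where d: "homog (int (length (omega_word a))) d (omega_elt a :: word \<Rightarrow> 'a)"
    "homog (int (olen as)) d' (omega_prod q as)"
    using homog_omega Cons by blast
  have "omega_prod q (a # as) = qstar q (omega_elt a) (omega_prod q as)"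
    by (simp add: omega_prod_def)
  also have "\<dots> = star q (omega_elt a) (omega_prod q as)"
    using d by (intro qstar_star homog_finite_supp)
  finally show ?case using Cons homog_star[OF d, of q] by (auto simp: olen_def)
qed

definition cat :: "omega set \<Rightarrow> omega set \<Rightarrow> omega set \<Rightarrow> omega list set" where
  "cat A B C = {as @ bs @ cs | as bs cs. as \<in> lists A \<and> bs \<in> lists B \<and> cs \<in> lists C}"

definition cspan :: "'a::field \<Rightarrow> omega list set \<Rightarrow> (word \<Rightarrow> 'a) set" where
  "cspan q L = fs.span ((\<lambda>l. sprod q (map omega_elt l)) ` L)"

lemma rev_cat: "l \<in> cat A B C \<Longrightarrow> rev l \<in> cat C B A"
proof -
  assume "l \<in> cat A B C"
  then obtain as bs cs where "l = as @ bs @ cs" "as \<in> lists A" "bs \<in> lists B" "cs \<in> lists C"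
    by (auto simp: cat_def)
  then have "rev l = rev cs @ rev bs @ rev as" "rev as \<in> lists A" "rev bs \<in> lists B" "rev cs \<in> lists C"
    by auto
  then show ?thesis unfolding cat_def by blast
qed

context qshuf
begin

lemma cspan_mult:
  assumes "f \<in> cspan q L" "g \<in> cspan q L'"
  shows "f \<star> g \<in> cspan q {l @ m | l m. l \<in> L \<and> m \<in> L'}" (is "_ \<in> ?V")
  unfolding cspan_def
proof (rule star_span_left[OF assms(1)[unfolded cspan_def] fs.subspace_span])
  fix s assume "s \<in> (\<lambda>l. sprod q (map omega_elt l)) ` L"
  then obtain l where l: "s = sprod q (map omega_elt l)" "l \<in> L" by blast
  show "s \<star> g \<in> fs.span ((\<lambda>l. sprod q (map omega_elt l)) ` {l @ m | l m. l \<in> L \<and> m \<in> L'})"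
  proof (rule star_span_right[OF assms(2)[unfolded cspan_def] fs.subspace_span])
    fix t assume "t \<in> (\<lambda>l. sprod q (map omega_elt l)) ` L'"
    then obtain m where m: "t = sprod q (map omega_elt m)" "m \<in> L'" by blast
    have "s \<star> t = sprod q (map omega_elt (l @ m))" by (simp add: l m sprod_append)
    then show "s \<star> t \<in> fs.span ((\<lambda>l. sprod q (map omega_elt l)) ` {l @ m | l m. l \<in> L \<and> m \<in> L'})"
      using l m by (intro fs.span_base) blast
  qed
qed

lemma alg_cspan: "alg q (omega_elt ` A) = cspan q (lists A)"
  by (simp add: alg_def cspan_def lists_image image_image)

lemma smul_cspan:
  assumes "f \<in> smul q (alg q (omega_elt ` A)) (smul q (alg q (omega_elt ` B)) (alg q (omega_elt ` C)))"
  shows "f \<in> cspan q (cat A B C)"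
proof -
  have 1: "smul q (alg q (omega_elt ` B)) (alg q (omega_elt ` C)) \<subseteq> cspan q {l @ m | l m. l \<in> lists B \<and> m \<in> lists C}"
    by (rule smul_subset) (auto simp: alg_cspan intro: cspan_mult, simp add: cspan_def)
  have 2: "{l @ m | l m. l \<in> lists A \<and> m \<in> {l @ m | l m. l \<in> lists B \<and> m \<in> lists C}} = cat A B C"
    by (auto simp: cat_def)
  have "smul q (alg q (omega_elt ` A)) (smul q (alg q (omega_elt ` B)) (alg q (omega_elt ` C))) \<subseteq> cspan q (cat A B C)"
  proof (rule smul_subset)
    fix a b assume "a \<in> alg q (omega_elt ` A)" "b \<in> smul q (alg q (omega_elt ` B)) (alg q (omega_elt ` C))"
    then show "a \<star> b \<in> cspan q (cat A B C)"
      using cspan_mult[of a "lists A" b "{l @ m | l m. l \<in> lists B \<and> m \<in> lists C}"] 1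
      unfolding 2 alg_cspan by blast
  qed (simp add: cspan_def)
  then show ?thesis using assms by blast
qed

lemma letters_cspan:
  defines "lw w \<equiv> sprod q (map (\<lambda>a. aw a (Suc 0)) w)"
  shows "lw w \<in> cspan q (cat (range Wneg) (range Gt) (range Wpos))"
    "lw w \<in> cspan q (cat (range Wneg) (range Wpos) (range Gt))"
    "lw w \<in> cspan q (cat (range Gt) (range Wneg) (range Wpos))"
  unfolding lw_def using letters_M[of w] letters_M2[of w] letters_M3[of w]
  unfolding oddX_omega oddY_omega evenX_omega alg_insert_vone
  by (blast intro: smul_cspan)+

lemma sprod_rev:
  assumes "\<And>f. f \<in> set fs \<Longrightarrow> \<exists>l d. homog l d f"
  shows "\<exists>c. sprod q fs = vscale c (sprod (inverse q) (rev fs))"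
  using assms
proof (induction fs)
  case Nil
  show ?case by (rule exI[of _ 1]) simp
next
  case (Cons f fs)
  interpret r: qshuf "inverse q" by (rule qshuf_inverse) unfold_locales
  obtain c where c: "sprod q fs = vscale c (sprod (inverse q) (rev fs))" using Cons by auto
  obtain l d l' d' where "homog l d f" "homog l' d' (sprod (inverse q) (rev fs))"
    using Cons.prems homog_sprod[of "rev fs" "inverse q"] by (metis list.set_intros set_rev)
  from star_inverse[OF q0 this] show ?case
    unfolding sprod_simps c by (intro exI[of _ "c * q powi (2 * d * d')"]) (simp add: r.sprod_append)
qed

lemma Ualg_letters:
  assumes "f \<in> Ualg q"
  shows "f \<in> alg q (range (\<lambda>a. aw a (Suc 0)))"
  using assms
proof (induction rule: Ualg.induct)
  case (mult f g)
  then show ?case by (simp add: qstar_star Ualg_finite alg_mult)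
next
  case (add f g)
  then show ?case by (simp add: vplus_plus fs.subspace_add)
next
  case (scale f c)
  then show ?case by (simp add: fs.subspace_scale)
next
  case gx
  have "vx = aw X (Suc 0)" by (simp add: vx_def aw_def)
  then show ?case by (metis gen_alg rangeI)
next
  case gy
  have "vy = aw Y (Suc 0)" by (simp add: vy_def aw_def)
  then show ?case by (metis gen_alg rangeI)
qed simp

lemma Ualg_subset:
  assumes "fs.subspace V" "\<And>w. sprod q (map (\<lambda>a. aw a (Suc 0)) w) \<in> V" "f \<in> Ualg q"
  shows "f \<in> V"
proof -
  have "alg q (range (\<lambda>a. aw a (Suc 0))) \<subseteq> V"
    unfolding alg_def using assms(1,2) by (intro fs.span_minimal) (auto simp: lists_image)
  then show ?thesis using Ualg_letters[OF assms(3)] by blast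
qed

text \<open>Reversal is applied twice: a product of letters for \<open>q\<close> is a scalar times
  the reversed product for \<open>inverse q\<close>; that is expanded into monomials in the blocks
  \<open>A\<close>, \<open>B\<close>, \<open>C\<close>, and each monomial is turned back into one
  for \<open>q\<close> with the blocks reversed.\<close>

lemma Ualg_cspan_rev:
  assumes "\<And>w. sprod (inverse q) (map (\<lambda>a. aw a (Suc 0)) w) \<in> cspan (inverse q) (cat A B C)" "f \<in> Ualg q"
  shows "f \<in> cspan q (cat C B A)"
proof (rule Ualg_subset[OF _ _ assms(2)])
  interpret r: qshuf "inverse q" by (rule qshuf_inverse) unfold_locales
  show sub: "fs.subspace (cspan q (cat C B A))" by (simp add: cspan_def)
  have "cspan (inverse q) (cat A B C) \<subseteq> cspan q (cat C B A)"
    unfolding cspan_def[of "inverse q"]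
  proof (intro fs.span_minimal sub image_subsetI)
    fix l assume "l \<in> cat A B C"
    then have l: "rev l \<in> cat C B A" by (rule rev_cat)
    obtain c where "sprod (inverse q) (map omega_elt l) = vscale c (sprod q (map omega_elt (rev l)))"
      using r.sprod_rev[of "map omega_elt l"] homog_omega by (fastforce simp: rev_map)
    then show "sprod (inverse q) (map omega_elt l) \<in> cspan q (cat C B A)"
      using l unfolding cspan_def by (auto intro: fs.span_scale fs.span_base)
  qed
  moreover fix w
  obtain c where "sprod q (map (\<lambda>a. aw a (Suc 0)) w) = vscale c (sprod (inverse q) (map (\<lambda>a. aw a (Suc 0)) (rev w)))"
    using sprod_rev[of "map (\<lambda>a. aw a (Suc 0)) w"] homog_aw by (fastforce simp: rev_map)
  ultimately show "sprod q (map (\<lambda>a. aw a (Suc 0)) w) \<in> cspan q (cat C B A)"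
    using assms(1)[of "rev w"] fs.subspace_scale[OF sub] by auto
qed

lemma Ualg_cspan:
  assumes "f \<in> Ualg q"
    and "(A, B, C) \<in> {(range Wneg, range Gt, range Wpos), (range Wpos, range Gt, range Wneg),
      (range Wpos, range Wneg, range Gt), (range Wneg, range Wpos, range Gt),
      (range Gt, range Wpos, range Wneg), (range Gt, range Wneg, range Wpos)}"
  shows "f \<in> cspan q (cat A B C)"
proof -
  interpret r: qshuf "inverse q" by (rule qshuf_inverse) unfold_locales
  have sub: "fs.subspace (cspan q L)" for L by (simp add: cspan_def)
  show ?thesis
    using assms(2) Ualg_subset[OF sub letters_cspan(1) assms(1)] Ualg_subset[OF sub letters_cspan(2) assms(1)]
      Ualg_subset[OF sub letters_cspan(3) assms(1)] Ualg_cspan_rev[OF r.letters_cspan(1) assms(1)]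
      Ualg_cspan_rev[OF r.letters_cspan(2) assms(1)] Ualg_cspan_rev[OF r.letters_cspan(3) assms(1)]
    by auto
qed

section \<open>Sorting inside the three families\<close>

lemma sprod_remove:
  assumes "x \<in> set l" "\<And>y. y \<in> set l \<Longrightarrow> x \<star> y = y \<star> x"
  shows "sprod q l = x \<star> sprod q (remove1 x l)"
  using assms
proof (induction l)
  case (Cons z l)
  show ?case
  proof (cases "z = x")
    case False
    then have "sprod q l = x \<star> sprod q (remove1 x l)" using Cons by simp
    then have "sprod q (z # l) = (z \<star> x) \<star> sprod q (remove1 x l)" by (simp add: assoc)
    also have "z \<star> x = x \<star> z" using Cons.prems by simp
    finally show ?thesis using False by (simp add: assoc)
  qed simp
qed simp

lemma sprod_perm:
  assumes "mset l = mset m" "\<And>x y. x \<in> set l \<Longrightarrow> y \<in> set l \<Longrightarrow> x \<star> y = y \<star> x"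
  shows "sprod q l = sprod q m"
  using assms
proof (induction l arbitrary: m)
  case (Cons x l)
  have set: "set m = set (x # l)" using Cons.prems(1) by (metis set_mset_mset)
  have "mset l = mset (remove1 x m)" using Cons.prems(1) by (metis add_mset_remove_trivial mset.simps(2) mset_remove1)
  then have "sprod q l = sprod q (remove1 x m)"
    using Cons.prems(2) by (intro Cons.IH) auto
  then show ?case using sprod_remove[of x m] set Cons.prems(2) by simp
qed simp

lemma omega_commute:
  assumes "a \<in> A" "b \<in> A" "A \<in> {range Wneg, range Gt, range Wpos}"
  shows "omega_elt a \<star> omega_elt b = omega_elt b \<star> omega_elt a"
  using assms odd_comm even_comm' by (auto simp: omega_elt_aw simp del: mult_Suc_right)

lemma ex_sorted:
  assumes "linear_order_rel le"
  shows "\<exists>m. mset m = mset l \<and> sorted_wrt le m"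
proof (induction l)
  case (Cons x l)
  then obtain m where m: "mset m = mset l" "sorted_wrt le m" by blast
  let ?m = "filter (\<lambda>y. \<not> le x y) m @ x # filter (le x) m"
  have "sorted_wrt le ?m"
  proof -
    have 1: "le y x" if "\<not> le x y" for y
      using assms that unfolding linear_order_rel_def by blast
    have 2: "le y z" if "\<not> le x y" "le x z" for y z
      using assms that unfolding linear_order_rel_def by blast
    show ?thesis
      unfolding sorted_wrt_append using m(2) by (auto intro: 1 2 sorted_wrt_filter)
  qed
  moreover have "mset ?m = mset (x # l)"
  proof -
    have e: "mset (filter P m) + mset (filter (\<lambda>y. \<not> P y) m) = mset m" for P
      by (induction m) auto
    have "mset ?m = add_mset x (mset (filter (le x) m) + mset (filter (\<lambda>y. \<not> le x y) m))" by simp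
    then show ?thesis by (simp only: e m(1) mset.simps)
  qed
  ultimately show ?case by blast
qed simp

text \<open>Members of one family commute, so each block can be rearranged to follow
  \<open>le\<close>, whatever order \<open>le\<close> induces inside the family.\<close>

lemma cspan_sorted:
  assumes le: "linear_order_rel le"
    and "\<And>a b. a \<in> A \<Longrightarrow> b \<in> B \<Longrightarrow> le a b" "\<And>b c. b \<in> B \<Longrightarrow> c \<in> C \<Longrightarrow> le b c" "B \<noteq> {}"
    and cl: "{A, B, C} \<subseteq> {range Wneg, range Gt, range Wpos}"
  shows "cspan q (cat A B C) \<subseteq> fs.span (omega_prod q ` {as. sorted_wrt le as})"
  unfolding cspan_def
proof (intro fs.span_minimal fs.subspace_span image_subsetI)
  fix l assume "l \<in> cat A B C"
  then obtain as bs cs where l: "l = as @ bs @ cs" "as \<in> lists A" "bs \<in> lists B" "cs \<in> lists C"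
    by (auto simp: cat_def)
  have *: "\<exists>m. set m \<subseteq> D \<and> sorted_wrt le m \<and> sprod q (map omega_elt m) = sprod q (map omega_elt as)"
    if "as \<in> lists D" "D \<in> {A, B, C}" for D as
  proof -
    obtain m where m: "mset m = mset as" "sorted_wrt le m" using ex_sorted[OF le] by blast
    have "set m = set as" using m(1) by (metis set_mset_mset)
    then have "set m \<subseteq> D" using that by auto
    moreover have "sprod q (map omega_elt m) = sprod q (map omega_elt as)"
    proof (rule sprod_perm)
      show "mset (map omega_elt m) = mset (map omega_elt as)" using m(1) by simp
      have D: "D \<in> {range Wneg, range Gt, range Wpos}" by (rule subsetD[OF cl that(2)])
      fix x y :: "word \<Rightarrow> 'a" assume "x \<in> set (map omega_elt m)" "y \<in> set (map omega_elt m)"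
      then obtain a b where "x = omega_elt a" "a \<in> D" "y = omega_elt b" "b \<in> D"
        using \<open>set m \<subseteq> D\<close> by auto
      then show "x \<star> y = y \<star> x" using omega_commute[OF _ _ D] by blast
    qed
    ultimately show ?thesis using m(2) by blast
  qed
  obtain as' where as': "set as' \<subseteq> A" "sorted_wrt le as'" "sprod q (map omega_elt as') = sprod q (map omega_elt as)"
    using *[OF l(2)] by blast
  obtain bs' where bs': "set bs' \<subseteq> B" "sorted_wrt le bs'" "sprod q (map omega_elt bs') = sprod q (map omega_elt bs)"
    using *[OF l(3)] by blast
  obtain cs' where cs': "set cs' \<subseteq> C" "sorted_wrt le cs'" "sprod q (map omega_elt cs') = sprod q (map omega_elt cs)"
    using *[OF l(4)] by blast
  \<comment> \<open>The outer blocks are compared through an element of \<open>B\<close>, which is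
    why \<open>B\<close> must be nonempty.\<close>
  have AC: "le a c" if "a \<in> A" "c \<in> C" for a c
    using that assms(2-4) le unfolding linear_order_rel_def by (metis ex_in_conv)
  have "sorted_wrt le (as' @ bs' @ cs')"
    using as' bs' cs' assms(2,3) AC by (auto simp: sorted_wrt_append subset_iff)
  moreover have "sprod q (map omega_elt l) = omega_prod q (as' @ bs' @ cs')"
    using omega_prod_sprod[of q "as' @ bs' @ cs'"] as' bs' cs' l by (simp add: sprod_append)
  ultimately show "sprod q (map omega_elt l) \<in> fs.span (omega_prod q ` {as. sorted_wrt le as})"
    by (auto intro: fs.span_base)
qed

lemma Ualg_span:
  assumes le: "linear_order_rel le" and adm: "admissible_order le" and f: "f \<in> Ualg q"
  shows "f \<in> fs.span (omega_prod q ` {as. sorted_wrt le as})"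
proof -
  have main: ?thesis
    if "(A, B, C) \<in> {(range Wneg, range Gt, range Wpos), (range Wpos, range Gt, range Wneg),
      (range Wpos, range Wneg, range Gt), (range Wneg, range Wpos, range Gt),
      (range Gt, range Wpos, range Wneg), (range Gt, range Wneg, range Wpos)}"
      and "\<And>a b. a \<in> A \<Longrightarrow> b \<in> B \<Longrightarrow> le a b" "\<And>b c. b \<in> B \<Longrightarrow> c \<in> C \<Longrightarrow> le b c" for A B C
  proof -
    have "{A, B, C} \<subseteq> {range Wneg, range Gt, range Wpos}" "B \<noteq> {}"
      using that(1) by (elim insertE emptyE; simp)+
    with cspan_sorted[OF le that(2,3)] Ualg_cspan[OF f that(1)] show ?thesis by blast
  qed
  show ?thesis
    using adm unfolding admissible_order_def Let_def strict_of_def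
  proof (elim disjE)
    assume *: "\<forall>i j k. (le (Wneg i) (Gt j) \<and> Wneg i \<noteq> Gt j) \<and> (le (Gt j) (Wpos k) \<and> Gt j \<noteq> Wpos k)"
    show ?thesis
      by (rule main[of "range Wneg" "range Gt" "range Wpos"]) (simp, use * in blast, use * in blast)
  next
    assume *: "\<forall>i j k. (le (Wpos k) (Gt j) \<and> Wpos k \<noteq> Gt j) \<and> (le (Gt j) (Wneg i) \<and> Gt j \<noteq> Wneg i)"
    show ?thesis
      by (rule main[of "range Wpos" "range Gt" "range Wneg"]) (simp, use * in blast, use * in blast)
  next
    assume *: "\<forall>i j k. (le (Wpos k) (Wneg i) \<and> Wpos k \<noteq> Wneg i) \<and> (le (Wneg i) (Gt j) \<and> Wneg i \<noteq> Gt j)"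
    show ?thesis
      by (rule main[of "range Wpos" "range Wneg" "range Gt"]) (simp, use * in blast, use * in blast)
  next
    assume *: "\<forall>i j k. (le (Wneg i) (Wpos k) \<and> Wneg i \<noteq> Wpos k) \<and> (le (Wpos k) (Gt j) \<and> Wpos k \<noteq> Gt j)"
    show ?thesis
      by (rule main[of "range Wneg" "range Wpos" "range Gt"]) (simp, use * in blast, use * in blast)
  next
    assume *: "\<forall>i j k. (le (Gt j) (Wpos k) \<and> Gt j \<noteq> Wpos k) \<and> (le (Wpos k) (Wneg i) \<and> Wpos k \<noteq> Wneg i)"
    show ?thesis
      by (rule main[of "range Gt" "range Wpos" "range Wneg"]) (simp, use * in blast, use * in blast)
  next
    assume *: "\<forall>i j k. (le (Gt j) (Wneg i) \<and> Gt j \<noteq> Wneg i) \<and> (le (Wneg i) (Wpos k) \<and> Wneg i \<noteq> Wpos k)"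
    show ?thesis
      by (rule main[of "range Gt" "range Wneg" "range Wpos"]) (simp, use * in blast, use * in blast)
  qed
qed

lemma omega_prod_Ualg: "omega_prod q as \<in> Ualg q"
proof -
  have "omega_elt a \<in> Ualg q" for a
    by (cases a) (simp_all only: omega_elt_aw aw_Ualg)
  then have "sprod q (map omega_elt as) \<in> Ualg q"
    by (induction as) (auto intro: Ualg.one Ualg_star)
  then show ?thesis using omega_prod_sprod by metis
qed


text \<open>Each ordered monomial in the alternating words has a companion of the same length, in
  which \<open>Ev q k\<close> replaces \<open>omega_elt (Wpos k)\<close>; the companions are the family with which the monomials are counted.\<close>

definition is_pos :: "omega \<Rightarrow> bool" where
  "is_pos a \<longleftrightarrow> a \<in> range Wpos"

text \<open>Descending, as \<open>aprod_indep\<close> expects; \<open>epart\<close> is ascending, as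
  \<open>eprod_indep\<close> expects. Both depend only on the multiset of entries, so companions are
  the same for every order \<open>le\<close>.\<close>

definition xpart :: "omega list \<Rightarrow> nat list" where
  "xpart as = rev (sort (map (length \<circ> omega_word) (filter (\<lambda>a. \<not> is_pos a) as)))"

definition epart :: "omega list \<Rightarrow> nat list" where
  "epart as = sort (map (inv Wpos) (filter is_pos as))"

definition companion :: "omega list \<Rightarrow> word \<Rightarrow> 'a" where
  "companion as = aprod q X (xpart as) \<star> eprod q (epart as)"

lemma is_pos_simps [simp]: "\<not> is_pos (Wneg i)" "\<not> is_pos (Gt j)" "is_pos (Wpos k)"
  by (auto simp: is_pos_def)

lemma inv_Wpos [simp]: "inv Wpos (Wpos k) = k"
  by (intro inv_f_f injI) simp

lemma mset_determined:
  assumes "xpart as = xpart bs" "epart as = epart bs"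
  shows "mset as = mset bs"
proof -
  \<comment> \<open>Among the words in Omega starting with \<open>X\<close> the length determines
    the element; \<open>Gt j\<close> has length \<open>2*j + 2\<close>, hence the shift by
    one.\<close>
  define w where "w = (\<lambda>n. if odd n then Wneg (n div 2) else Gt (n div 2 - 1))"
  have x: "mset (map w (xpart as)) = mset (filter (\<lambda>a. \<not> is_pos a) as)" for as
  proof -
    have "map (w \<circ> (length \<circ> omega_word)) (filter (\<lambda>a. \<not> is_pos a) as) = map id (filter (\<lambda>a. \<not> is_pos a) as)"
    proof (rule map_cong)
      fix a assume "a \<in> set (filter (\<lambda>a. \<not> is_pos a) as)"
      then have "\<not> is_pos a" by simp
      then show "(w \<circ> (length \<circ> omega_word)) a = id a" by (cases a) (auto simp: w_def)
    qed simp
    moreover have "mset (map w (xpart as)) = mset (map (w \<circ> (length \<circ> omega_word)) (filter (\<lambda>a. \<not> is_pos a) as))"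
      by (simp only: xpart_def mset_map mset_rev mset_sort image_mset.compositionality)
    ultimately show ?thesis by simp
  qed
  have e: "mset (map Wpos (epart as)) = mset (filter is_pos as)" for as
  proof -
    have "map (Wpos \<circ> inv Wpos) (filter is_pos as) = map id (filter is_pos as)"
      by (rule map_cong) (auto simp: is_pos_def)
    moreover have "mset (map Wpos (epart as)) = mset (map (Wpos \<circ> inv Wpos) (filter is_pos as))"
      by (simp only: epart_def mset_map mset_sort image_mset.compositionality)
    ultimately show ?thesis by simp
  qed
  have "mset as = mset (filter is_pos as) + mset (filter (\<lambda>a. \<not> is_pos a) as)" for as
    by (induction as) auto
  then show ?thesis using x[of as] x[of bs] e[of as] e[of bs] assms by metis
qed

lemma sorted_unique:
  assumes "linear_order_rel le" "sorted_wrt le as" "sorted_wrt le bs" "mset as = mset bs"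
  shows "as = bs"
  using assms(2-)
proof (induction as arbitrary: bs)
  case (Cons a as)
  then obtain b bs' where bs: "bs = b # bs'" by (cases bs) auto
  have "a \<in> set bs" "b \<in> set (a # as)"
    using Cons.prems(3) bs by (metis list.set_intros(1) set_mset_mset)+
  then have "a = b \<or> le a b \<and> le b a" using Cons.prems bs by auto
  then have "a = b" using assms(1) unfolding linear_order_rel_def by blast
  then show ?case using Cons bs by auto
qed simp

lemma homog_aprod: "\<exists>d. homog (int (sum_list T)) d (aprod q a T)"
proof (induction T)
  case (Cons n T)
  then show ?case using homog_star[OF homog_aw] by (metis aprod_simps(2) of_nat_add sum_list.Cons)
qed (use homog_vone in auto)

lemma olen_parts: "sum_list (xpart as) + elen (epart as) = olen as"
proof -
  have "sum_list (xpart as) = sum_list (map (length \<circ> omega_word) (filter (\<lambda>a. \<not> is_pos a) as))"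
    by (simp add: xpart_def sum_list_rev flip: sum_mset_sum_list)
  moreover have "elen (epart as) = elen (map (inv Wpos) (filter is_pos as))"
    by (simp add: epart_def elen_def image_mset.compositionality o_def flip: sum_mset_sum_list)
  moreover have "sum_list (map (length \<circ> omega_word) (filter (\<lambda>a. \<not> is_pos a) as))
    + elen (map (inv Wpos) (filter is_pos as)) = olen as"
  proof (induction as)
    case (Cons a as)
    then show ?case by (cases a) (auto simp: olen_def)
  qed (simp add: olen_def)
  ultimately show ?thesis by simp
qed

lemma homog_companion: "\<exists>d. homog (int (olen as)) d (companion as)"
proof -
  obtain d where "homog (int (sum_list (xpart as))) d (aprod q X (xpart as))"
    using homog_aprod by blast
  from homog_star[OF this homog_eprod, of "epart as" q q] show ?thesis
    unfolding companion_def by (metis olen_parts of_nat_add)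
qed

lemma companion_Ualg: "companion as \<in> Ualg q"
proof -
  have aw: "aw X n \<in> Ualg q" for n
    using aw_Ualg[of "n div 2"] by (cases "even n") (auto elim!: evenE oddE)
  have "aprod q X T \<in> Ualg q" for T
    by (induction T) (auto intro: Ualg.one Ualg_star aw)
  moreover have "eprod q \<nu> \<in> Ualg q" for \<nu>
    by (induction \<nu>) (auto intro: Ualg.one Ualg_star Ev_Ualg)
  ultimately show ?thesis unfolding companion_def by (intro Ualg_star)
qed

lemma companion_indep:
  assumes le: "linear_order_rel le" and "finite I" "I \<subseteq> {as. sorted_wrt le as}"
    and sum: "(\<Sum>as\<in>I. vscale (c as) (companion as)) = 0"
  shows "\<forall>as\<in>I. c as = 0"
proof -
  define g where "g = (\<lambda>as. (xpart as, epart as))"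
  have inj: "inj_on g I"
  proof (rule inj_onI)
    fix as bs assume "as \<in> I" "bs \<in> I" "g as = g bs"
    then have "sorted_wrt le as" "sorted_wrt le bs" "mset as = mset bs"
      using assms(3) mset_determined[of as bs] by (auto simp: g_def)
    then show "as = bs" by (rule sorted_unique[OF le])
  qed
  define c' where "c' = (\<lambda>T \<nu>. c (inv_into I g (T, \<nu>)))"
  have "(\<Sum>(T, \<nu>)\<in>g ` I. vscale (c' T \<nu>) (aprod q X T \<star> eprod q \<nu>))
    = (\<Sum>as\<in>I. vscale (c (inv_into I g (g as))) (companion as))"
    by (simp add: sum.reindex[OF inj] case_prod_beta c'_def companion_def) (simp add: g_def)
  also have "\<dots> = (\<Sum>as\<in>I. vscale (c as) (companion as))"
    by (rule sum.cong) (simp_all add: inv_into_f_f[OF inj])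
  finally have "(\<Sum>(T, \<nu>)\<in>g ` I. vscale (c' T \<nu>) (aprod q X T \<star> eprod q \<nu>)) = 0"
    using sum by simp
  then have "\<forall>(T, \<nu>)\<in>g ` I. c' T \<nu> = 0"
  proof (rule aprod_eprod_indep[rotated 2])
    have "0 \<notin> set (xpart as)" for as
    proof -
      have "length (omega_word a) \<noteq> 0" for a by (cases a) auto
      then show ?thesis by (auto simp: xpart_def)
    qed
    moreover have "sorted_wrt (\<ge>) (rev l)" if "sorted l" for l :: "nat list"
      using that by (simp add: sorted_wrt_rev)
    ultimately show "\<forall>(T, \<nu>)\<in>g ` I. sorted_wrt (\<ge>) T \<and> 0 \<notin> set T \<and> sorted \<nu>"
      by (auto simp: g_def xpart_def epart_def)
  qed (use assms(2) in simp)
  then have "c' (fst (g as)) (snd (g as)) = 0" if "as \<in> I" for as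
    using that by (simp add: case_prod_beta)
  then show ?thesis by (simp add: c'_def inv_into_f_f[OF inj])
qed

section \<open>Comparison of dimensions length by length\<close>

lemma finite_olen: "finite {as. olen as = n}"
proof (rule finite_subset)
  let ?A = "Wneg ` {..n} \<union> Gt ` {..n} \<union> Wpos ` {..n}"
  have "a \<in> ?A \<and> 1 \<le> length (omega_word a)" if "length (omega_word a) \<le> n" for a
    using that by (cases a) auto
  moreover have "length (omega_word a) \<le> olen as" if "a \<in> set as" for a as
    unfolding olen_def using that by (intro member_le_sum_list) auto
  moreover have "length as \<le> olen as" for as
  proof (induction as)
    case (Cons a as)
    moreover have "length (omega_word a) \<ge> 1" by (cases a) auto
    ultimately show ?case by (simp add: olen_def)
  qed simp
  ultimately show "{as. olen as = n} \<subseteq> {as. set as \<subseteq> ?A \<and> length as \<le> n}"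
    by blast
  show "finite {as. set as \<subseteq> ?A \<and> length as \<le> n}"
    by (rule finite_lists_length_le) simp
qed

text \<open>Monomials are homogeneous for length, so terms of other lengths may be dropped. This
  places the companions of one length into the span of the finitely many ordered monomials of that
  length.\<close>

lemma span_homogeneous:
  assumes "f \<in> fs.span (omega_prod q ` I)" "homog (int n) d f"
  shows "f \<in> fs.span (omega_prod q ` {as\<in>I. olen as = n})"
proof -
  obtain F c where F: "finite F" "F \<subseteq> I" "f = (\<Sum>as\<in>F. vscale (c as) (omega_prod q as))"
    using assms(1) by (rule span_familyE)
  have "f = (\<Sum>as\<in>{as\<in>F. olen as = n}. vscale (c as) (omega_prod q as))" (is "f = ?g")
  proof
    fix w
    have hom: "olen as = length w" if "omega_prod q as w \<noteq> 0" for as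
      using omega_prod_sprod[of q as] that by (auto simp: homog_def)
    show "f w = ?g w"
    proof (cases "length w = n")
      case True
      then show ?thesis unfolding F(3)
        using F(1) hom by (auto simp: sum_apply pointwise intro!: sum.mono_neutral_right)
    next
      case False
      then have "f w = 0" using assms(2) by (auto simp: homog_def)
      moreover have "?g w = 0" using hom False by (auto simp: sum_apply pointwise intro!: sum.neutral)
      ultimately show ?thesis by simp
    qed
  qed
  also have "\<dots> \<in> fs.span (omega_prod q ` {as\<in>I. olen as = n})"
    using F(2) by (intro fs.span_sum fs.span_scale fs.span_base) blast
  finally show ?thesis .
qed

lemma omega_prod_indep:
  assumes le: "linear_order_rel le" and adm: "admissible_order le"
    and F: "finite F" "F \<subseteq> {as. sorted_wrt le as}"
    and sum: "(\<Sum>as\<in>F. vscale (c as) (omega_prod q as)) = 0" and "bs \<in> F"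
  shows "c bs = 0"
proof -
  define n where "n = olen bs"
  define I where "I = {as. sorted_wrt le as \<and> olen as = n}"
  \<comment> \<open>The transfer needs all of \<open>I\<close> as index set, for only the whole of
    \<open>I\<close> spans the companions; coefficients outside \<open>F\<close> are set to
    zero.\<close>
  define c' where "c' = (\<lambda>as. if as \<in> F then c as else 0)"
  have fin: "finite I"
    by (rule finite_subset[OF _ finite_olen[of n]]) (auto simp: I_def)
  have "(\<Sum>as\<in>I. vscale (c' as) (omega_prod q as)) = 0"
  proof
    fix w
    have hom: "omega_prod q as w = 0" if "length w \<noteq> olen as" for as
      using omega_prod_sprod[of q as] that by (auto simp: homog_def)
    show "(\<Sum>as\<in>I. vscale (c' as) (omega_prod q as)) w = 0 w"
    proof (cases "length w = n")
      case False
      then show ?thesis using hom by (auto simp: I_def sum_apply pointwise intro!: sum.neutral)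
    next
      case True
      have "(\<Sum>as\<in>I. c' as * omega_prod q as w) = (\<Sum>as\<in>F. c as * omega_prod q as w)"
      proof (rule sum.mono_neutral_cong)
        show "c' as * omega_prod q as w = 0" if "as \<in> I - F" for as using that by (simp add: c'_def)
        show "c as * omega_prod q as w = 0" if "as \<in> F - I" for as
          using that F(2) hom[of as] True by (auto simp: I_def)
      qed (use fin F in \<open>auto simp: c'_def\<close>)
      also have "\<dots> = 0" using fun_cong[OF sum, of w] by (simp add: sum_apply pointwise)
      finally show ?thesis by (simp add: sum_apply pointwise)
    qed
  qed
  then have "c' bs = 0"
  proof (rule independent_family_transfer[OF fin, where J = companion, rotated 2])
    show "bs \<in> I" using F \<open>bs \<in> F\<close> by (auto simp: I_def n_def)
    fix as assume "as \<in> I"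
    obtain d where "homog (int (olen as)) d (companion as)" using homog_companion by blast
    then show "companion as \<in> fs.span (omega_prod q ` I)"
      using span_homogeneous[OF Ualg_span[OF le adm companion_Ualg[of as]]] \<open>as \<in> I\<close>
      by (auto simp: I_def)
  next
    show "\<forall>as\<in>I. c as = 0" if "(\<Sum>as\<in>I. vscale (c as) (companion as)) = 0" for c
      using companion_indep[OF le fin _ that] by (auto simp: I_def)
  qed
  then show ?thesis using \<open>bs \<in> F\<close> by (simp add: c'_def)
qed

end

theorem theorem10p1:
  fixes q :: "'a::field" and le :: "omega \<Rightarrow> omega \<Rightarrow> bool"
  assumes "q \<noteq> 0"
    and "\<forall>n::nat. n > 0 \<longrightarrow> q ^ n \<noteq> 1"
    and "linear_order_rel le"
    and "admissible_order le"
  shows "is_basis_family (omega_prod q) {as. sorted_wrt le as} (Ualg q)"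
proof -
  interpret qshuf q using assms(1,2) by unfold_locales auto
  have eq: "(\<Sum>i\<in>F. c i * omega_prod q i w) = (\<Sum>i\<in>F. vscale (c i) (omega_prod q i)) w" for F c w
    by (simp add: sum_apply pointwise)
  show ?thesis
    unfolding is_basis_family_def eq
  proof (intro conjI ballI allI impI)
    show "omega_prod q as \<in> Ualg q" for as
      by (rule omega_prod_Ualg)
    show "c as = 0" if "finite F" "F \<subseteq> {as. sorted_wrt le as}"
      "\<forall>w. (\<Sum>i\<in>F. vscale (c i) (omega_prod q i)) w = 0" "as \<in> F" for F c as
      using omega_prod_indep[OF assms(3,4) that(1,2) _ that(4)] that(3) by (auto simp: fun_eq_iff pointwise)
    show "\<exists>F c. finite F \<and> F \<subseteq> {as. sorted_wrt le as} \<and> (\<forall>w. f w = (\<Sum>i\<in>F. vscale (c i) (omega_prod q i)) w)"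
      if "f \<in> Ualg q" for f
      using Ualg_span[OF assms(3,4) that] by (elim span_familyE) blast
  qed
qed

end
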